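(* Let $\mu$ be a probability distribution on $\mathbb{R}^{d\times d}$ with compact support and let $\mathcal{M}=\operatorname{supp}\mu$. Assume that (a) $\mathcal{M}$ leaves a proper cone in $\mathbb{R}^d$ invariant; and (b) the singular part $\mu_s$ of $\mu$ consists of only point measures, i.e. $\mu_s=\sum_{i=1}^N p_i\delta_{M_i}$ for some positive numbers $p_1,\dots,p_N$ and matrices $M_1,\dots,M_N$. Then $$\lim_{p\to\infty}\rho_{p,\mu}=\hat\rho(\mathcal{M}).$$
   Context: $p$ ranges over positive integers. The $L^p$-norm joint spectral radius of $\mu$ is $$\rho_{p,\mu}:=\lim_{k\to\infty}\left(E[\|A_k\cdots A_1\|^p]\right)^{1/(pk)},$$ where $A_1,A_2,\dots$ are independent random matrices with distribution $\mu$ and $\|\cdot\|$ is any norm on $\mathbb{R}^{d\times d}$ (the limit exists, is finite, and does not depend on the norm). The joint spectral radius of a set $\mathcal{M}\subset\mathbb{R}^{d\times d}$ is $$\hat\rho(\mathcal{M}):=\limsup_{k\to\infty}\sup_{A_1,\dots,A_k\in\mathcal{M}}\|A_k\cdots A_1\|^{1/k}.$$ The singular part $\mu_s$ is that of the Lebesgue decomposition of $\mu$ with respect to Lebesgue measure on $\mathbb{R}^{d\times d}$; the case $\mu_s=0$ ($N=0$) is allowed. $\delta_M$ is the Dirac measure at $M$. A subset $K\subset\mathbb{R}^d$ is a cone if it is closed under multiplication by nonnegative scalars; it is proper if it is closed, convex, has nonempty interior, and is pointed ($x,-x\in K$ implies $x=0$). $\mathcal{M}$ leaves $K$ invariant if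 $MK\subset K$ for every $M\in\mathcal{M}$. *)

theory Defs
  imports "HOL-Probability.Probability"
begin

definition is_norm :: "('a::real_vector \<Rightarrow> real) \<Rightarrow> bool" where
  "is_norm N \<longleftrightarrow>
     (\<forall>x. 0 \<le> N x) \<and> (\<forall>x. N x = 0 \<longleftrightarrow> x = 0) \<and>
     (\<forall>c x. N (c *\<^sub>R x) = \<bar>c\<bar> * N x) \<and> (\<forall>x y. N (x + y) \<le> N x + N y)"

text \<open>The product \<open>A k ** \<dots> ** A 1\<close>, newest factor on the left.\<close>

fun mat_prod :: "(nat \<Rightarrow> real^'n^'n) \<Rightarrow> nat \<Rightarrow> real^'n^'n" where
  "mat_prod A 0 = mat 1"
| "mat_prod A (Suc k) = A (Suc k) ** mat_prod A k"

text \<open>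
  The matrices \<open>A 1, \<dots>, A k\<close> are the coordinates of the \<open>k\<close>-fold product measure. Lemma
  \<open>expectation_mat_prod_iid\<close> below shows that any other independent random matrices with
  distribution \<open>\<mu>\<close> give the same expectation.
\<close>

definition Lp_moment :: "(real^'n^'n \<Rightarrow> real) \<Rightarrow> nat \<Rightarrow> (real^'n^'n) measure \<Rightarrow> nat \<Rightarrow> real" where
  "Lp_moment N p \<mu> k = (\<integral>A. N (mat_prod A k) ^ p \<partial>(\<Pi>\<^sub>M i\<in>{1..k}. \<mu>))"

definition Lp_jsr :: "(real^'n^'n \<Rightarrow> real) \<Rightarrow> nat \<Rightarrow> (real^'n^'n) measure \<Rightarrow> real" where
  "Lp_jsr N p \<mu> = lim (\<lambda>k. Lp_moment N p \<mu> k powr (1 / (real p * real k)))"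

text \<open>Extended-real valued, so that neither the supremum nor the limsup needs a boundedness
  side condition.\<close>

definition jsr :: "(real^'n^'n \<Rightarrow> real) \<Rightarrow> (real^'n^'n) set \<Rightarrow> ereal" where
  "jsr N \<M> = limsup (\<lambda>k. SUP A\<in>{1..k} \<rightarrow> \<M>. ereal (N (mat_prod A k) powr (1 / real k)))"

definition measure_support :: "'a::topological_space measure \<Rightarrow> 'a set" where
  "measure_support \<mu> = {x. \<forall>U. open U \<longrightarrow> x \<in> U \<longrightarrow> 0 < emeasure \<mu> U}"

definition mutually_singular :: "'a measure \<Rightarrow> 'a measure \<Rightarrow> bool" where
  "mutually_singular \<nu> \<kappa> \<longleftrightarrow>
     sets \<nu> = sets \<kappa> \<and> (\<exists>S\<in>sets \<kappa>. emeasure \<kappa> S = 0 \<and> emeasure \<nu> (space \<kappa> - S) = 0)"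

definition singular_part :: "'a::euclidean_space measure \<Rightarrow> 'a measure \<Rightarrow> bool" where
  "singular_part \<mu> \<mu>s \<longleftrightarrow>
     (\<exists>\<mu>a. sets \<mu>a = sets borel \<and> sets \<mu>s = sets borel \<and>
       absolutely_continuous lborel \<mu>a \<and> mutually_singular \<mu>s lborel \<and>
       (\<forall>B\<in>sets borel. emeasure \<mu> B = emeasure \<mu>a B + emeasure \<mu>s B))"

definition proper_cone :: "'a::real_normed_vector set \<Rightarrow> bool" where
  "proper_cone K \<longleftrightarrow>
     cone K \<and> closed K \<and> convex K \<and> interior K \<noteq> {} \<and> (\<forall>x. x \<in> K \<longrightarrow> - x \<in> K \<longrightarrow> x = 0)"

definition leaves_invariant :: "(real^'n^'n) set \<Rightarrow> (real^'n) set \<Rightarrow> bool" where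
  "leaves_invariant \<M> K \<longleftrightarrow> (\<forall>M\<in>\<M>. (\<lambda>x. M *v x) ` K \<subseteq> K)"

lemma mat_prod_cong:
  assumes "\<And>i. i \<in> {1..k} \<Longrightarrow> A i = B i"
  shows "mat_prod A k = mat_prod B k"
  using assms by (induction k) auto

lemma measurable_mat_mult:
  "(\<lambda>(A, B). A ** B) \<in> borel_measurable (borel :: ((real^'n^'n) \<times> (real^'n^'n)) measure)"
  unfolding matrix_matrix_mult_def case_prod_unfold
  by (intro borel_measurable_continuous_onI continuous_intros)

lemma measurable_mat_prod:
  assumes "\<And>i. i \<in> {1..k} \<Longrightarrow> (\<lambda>x. A x i) \<in> borel_measurable M"
  shows "(\<lambda>x. mat_prod (A x) k :: real^'n^'n) \<in> borel_measurable M"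
  using assms
proof (induction k)
  case 0
  then show ?case by simp
next
  case (Suc k)
  have "(\<lambda>x. (A x (Suc k), mat_prod (A x) k)) \<in> borel_measurable M"
    using Suc by (intro borel_measurable_Pair) auto
  from measurable_compose[OF this measurable_mat_mult] show ?case
    by simp
qed

lemma expectation_mat_prod_iid:
  fixes X :: "nat \<Rightarrow> 'w \<Rightarrow> real^'n^'n"
  assumes P: "prob_space P"
    and indep: "prob_space.indep_vars P (\<lambda>_. borel) X {1..}"
    and distr: "\<And>i. i \<ge> 1 \<Longrightarrow> distr P borel (X i) = \<mu>"
    and N: "N \<in> borel_measurable borel"
    and k: "k \<ge> 1"
  shows "(\<integral>\<omega>. N (mat_prod (\<lambda>i. X i \<omega>) k) ^ p \<partial>P) = Lp_moment N p \<mu> k"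
proof -
  interpret prob_space P by fact
  have ind: "indep_vars (\<lambda>_. borel) X {1..k}"
    using indep by (rule indep_vars_subset) auto
  have rv [measurable]: "X i \<in> borel_measurable P" if "i \<in> {1..k}" for i
    using ind that by (auto simp: indep_vars_def)
  let ?X = "\<lambda>\<omega>. \<lambda>i\<in>{1..k}. X i \<omega>"
  have "distr P (\<Pi>\<^sub>M i\<in>{1..k}. borel) ?X = (\<Pi>\<^sub>M i\<in>{1..k}. distr P borel (X i))"
    using indep_vars_iff_distr_eq_PiM'[of "{1..k}" X "\<lambda>_. borel"] rv ind k by auto
  also have "\<dots> = (\<Pi>\<^sub>M i\<in>{1..k}. \<mu>)"
    by (intro PiM_cong) (auto simp: distr)
  finally have D: "distr P (\<Pi>\<^sub>M i\<in>{1..k}. borel) ?X = (\<Pi>\<^sub>M i\<in>{1..k}. \<mu>)" .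
  have mp: "(\<lambda>A. mat_prod A k) \<in> borel_measurable (\<Pi>\<^sub>M i\<in>{1..k}. borel)"
    by (rule measurable_mat_prod) auto
  have f: "(\<lambda>A. N (mat_prod A k) ^ p) \<in> borel_measurable (\<Pi>\<^sub>M i\<in>{1..k}. borel)"
    using measurable_compose[OF mp N] by simp
  have "Lp_moment N p \<mu> k = (\<integral>\<omega>. N (mat_prod (?X \<omega>) k) ^ p \<partial>P)"
    unfolding Lp_moment_def D[symmetric]
    by (rule integral_distr[OF _ f]) (rule measurable_restrict, rule rv)
  also have "\<dots> = (\<integral>\<omega>. N (mat_prod (\<lambda>i. X i \<omega>) k) ^ p \<partial>P)"
    by (intro Bochner_Integration.integral_cong refl arg_cong[where f = "\<lambda>M. N M ^ p"] mat_prod_cong) auto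
  finally show ?thesis by simp
qed

end

theory Submission
  imports Defs "HOL-Computational_Algebra.Fundamental_Theorem_Algebra"
begin

text \<open>
  The inequality \<open>Lp_jsr N p \<mu> \<le> jsr N (supp \<mu>)\<close> holds because almost every random product has
  all its factors in the support. For the converse let \<open>q\<close> be smaller than the joint spectral radius.
  It suffices to find matrices \<open>X 1, \<dots>, X k\<close> that map the cone \<open>K\<close> into itself and a nonzero
  \<open>v \<in> K\<close> such that (i) \<open>X k \<dots> X 1 v \<ge> q ^ k v\<close> in the order of \<open>K\<close>, and (ii) with positive
  probability a random matrix \<open>Y\<close> dominates \<open>X i\<close>, in the sense that \<open>Y - X i\<close> maps \<open>K\<close> into
  itself. Indeed, if all these probabilities are at least \<open>d\<close>, then with probability at least
  \<open>d ^ (n k)\<close> the product of \<open>n k\<close> random matrices dominates \<open>(X k \<dots> X 1) ^ n\<close> and so has norm at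
  least \<open>const * q ^ (n k)\<close>. This gives \<open>d powr (1/p) * q \<le> Lp_jsr N p \<mu>\<close> (lemma \<open>Lp_jsr_ge\<close>), and
  since \<open>d\<close> does not depend on \<open>p\<close>, the left side tends to \<open>q\<close> as \<open>p \<rightarrow> \<infinity>\<close>.

  The assumption on the singular part enters in (ii). Let \<open>P\<close> be the cone of matrices that preserve
  \<open>K\<close>; it has interior points. Call a matrix \<open>X\<close> charged if \<open>\<mu> (X + P) > 0\<close>. The matrices of a set
  \<open>S\<close> that avoid all the translates \<open>X + interior P\<close> with \<open>X \<in> S\<close> meet each line in an interior
  direction of \<open>P\<close> at most once, so they form a Lebesgue null set. If no point of \<open>S\<close> were charged,
  then all of the mass of \<open>S\<close> would sit on such a null set and so on atoms; but an atom is charged.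
  Hence the charged matrices are dense in the support (lemma \<open>charged_translates_dense\<close>).

  For (i), products of charged matrices in the support have the same joint spectral radius as the
  support, by density. By the theorem of Berger and Wang this radius is the supremum of \<open>r(\<Pi>) powr (1/k)\<close> over
  products \<open>\<Pi>\<close> of \<open>k\<close> charged matrices, where \<open>r\<close> is the spectral radius (lemma
  \<open>Berger_Wang_bound\<close>). As \<open>\<Pi>\<close> preserves \<open>K\<close>, the Perron theorem provides an eigenvector in \<open>K\<close>
  whose eigenvalue is at least \<open>r(\<Pi>)\<close> (lemma \<open>perron_eigenvector\<close>).

  The Berger-Wang bound is proved as follows. For \<open>l\<close> slightly above the joint spectral radius there is
  a norm in which every factor has operator norm at most \<open>l\<close>, and there are trajectories
  \<open>y i = l ^ (-i) A i \<dots> A 1 x\<close> whose norms stay between \<open>1/2\<close> and \<open>1\<close> for a prescribed number of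
  steps. By a packing argument two points of a long trajectory are close together. So some normalized
  product \<open>T\<close> is a contraction that moves a vector of norm at least \<open>1/2\<close> by less than \<open>e\<close>.
  If all eigenvalues of \<open>T\<close> have modulus at most \<open>s < 1\<close>, this is impossible for small \<open>e\<close>, with
  a threshold that depends only on \<open>s\<close> and the dimension (lemma \<open>almost_fixed_vector_bound\<close>).
\<close>

section \<open>Vectors that a contraction almost fixes\<close>

lemma root_product_factorization:
  fixes p :: "complex poly"
  assumes "lead_coeff p = 1"
  shows "\<exists>R. size R = degree p \<and> p = (\<Prod>z\<in>#R. [:-z, 1:])"
proof -
  have "p \<noteq> 0" using assms by auto
  from alg_closed_imp_factorization[OF this] assms show ?thesis by simp
qed

text \<open>
  Each factor \<open>X - z\<close> at most doubles the sum of the moduli of the coefficients.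
\<close>

lemma sum_norm_coeff_root_product_le:
  fixes R :: "complex multiset"
  assumes "\<And>z. z \<in># R \<Longrightarrow> norm z \<le> 1"
  shows "(\<Sum>i\<le>n. norm (coeff (\<Prod>z\<in>#R. [:-z, 1:]) i)) \<le> 2 ^ size R"
  using assms
proof (induction R arbitrary: n)
  case empty
  have "(\<Sum>i\<le>n. norm (coeff (1::complex poly) i)) = (\<Sum>i\<le>n. if i = 0 then 1 else 0)"
    by (intro sum.cong) (auto simp: coeff_1)
  then show ?case by simp
next
  case (add z R)
  let ?p = "\<Prod>z\<in>#R. [:-z, 1:]"
  have z: "norm z \<le> 1" using add.prems by simp
  have IH: "(\<Sum>i\<le>n. norm (coeff ?p i)) \<le> 2 ^ size R" for n
    using add by simp
  have "norm (coeff ([:-z, 1:] * ?p) i) \<le> norm (coeff ?p i) + (if i = 0 then 0 else norm (coeff ?p (i - 1)))" for i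
  proof -
    have "norm (z * coeff ?p i) \<le> norm (coeff ?p i)"
      using z by (simp add: norm_mult mult_left_le_one_le)
    moreover have "coeff ([:-z, 1:] * ?p) i = (if i = 0 then 0 else coeff ?p (i - 1)) - z * coeff ?p i"
      by (cases i) (auto simp: algebra_simps)
    ultimately show ?thesis
      using norm_triangle_ineq4[of "if i = 0 then 0 else coeff ?p (i - 1)" "z * coeff ?p i"]
      by (auto split: if_splits)
  qed
  then have "(\<Sum>i\<le>n. norm (coeff ([:-z, 1:] * ?p) i))
     \<le> (\<Sum>i\<le>n. norm (coeff ?p i) + (if i = 0 then 0 else norm (coeff ?p (i - 1))))"
    by (intro sum_mono)
  also have "\<dots> = (\<Sum>i\<le>n. norm (coeff ?p i)) + (\<Sum>i\<le>n. if i = 0 then 0 else norm (coeff ?p (i - 1)))"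
    by (rule sum.distrib)
  also have "(\<Sum>i\<le>n. if i = 0 then 0 else norm (coeff ?p (i - 1))) \<le> 2 ^ size R"
  proof (cases n)
    case (Suc m)
    show ?thesis unfolding Suc sum.atMost_Suc_shift using IH[of m] by simp
  qed simp
  also have "(\<Sum>i\<le>n. norm (coeff ?p i)) \<le> 2 ^ size R" by (rule IH)
  finally show ?case by simp
qed

lemma norm_poly_root_product_ge:
  fixes R :: "complex multiset"
  assumes "\<And>z. z \<in># R \<Longrightarrow> norm z \<le> s" "s \<le> 1"
  shows "(1 - s) ^ size R \<le> norm (poly (\<Prod>z\<in>#R. [:-z, 1:]) 1)"
  using assms
proof (induction R)
  case (add z R)
  have "1 - s \<le> norm (1 - z)"
    using add.prems norm_triangle_ineq2[of 1 z] by force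
  then have "(1 - s) * (1 - s) ^ size R \<le> norm (1 - z) * norm (poly (\<Prod>z\<in>#R. [:-z, 1:]) 1)"
    using add by (intro mult_mono) auto
  also have "\<dots> = norm (poly (\<Prod>z\<in>#add_mset z R. [:-z, 1:]) 1)"
    by (simp add: norm_mult[symmetric] algebra_simps)
  finally show ?case by simp
qed simp

text \<open>
  For a real linear map, \<open>z\<close> is an eigenvalue of the complexification with eigenvector \<open>u + \<i> v\<close>. The
  real and imaginary parts are kept apart so that no complexified space is needed.
\<close>

definition real_eigenpair :: "('a::real_vector \<Rightarrow> 'a) \<Rightarrow> complex \<Rightarrow> bool" where
  "real_eigenpair T z \<longleftrightarrow> (\<exists>u v. (u \<noteq> 0 \<or> v \<noteq> 0) \<and>
     T u = Re z *\<^sub>R u - Im z *\<^sub>R v \<and> T v = Im z *\<^sub>R u + Re z *\<^sub>R v)"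

text \<open>
  The first linear dependence in the sequence \<open>x, T x, T\<^sup>2 x, \<dots>\<close>, normalized to be monic. By minimality
  the earlier iterates are independent.
\<close>

lemma krylov_relation:
  fixes T :: "'a::euclidean_space \<Rightarrow> 'a"
  obtains D c where "D \<le> DIM('a)" "(T ^^ D) x = (\<Sum>i<D. c i *\<^sub>R (T ^^ i) x)"
    and "\<forall>c. (\<Sum>i<D. c i *\<^sub>R (T ^^ i) x) = 0 \<longrightarrow> (\<forall>i<D. c i = 0)"
proof -
  define Q where "Q = (\<lambda>D. \<exists>c. (\<Sum>i\<le>D. c i *\<^sub>R (T ^^ i) x) = 0 \<and> (\<exists>i\<le>D. c i \<noteq> 0))"
  have "Q DIM('a)"
  proof (cases "inj_on (\<lambda>i. (T ^^ i) x) {..DIM('a)}")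
    case True
    let ?S = "(\<lambda>i. (T ^^ i) x) ` {..DIM('a)}"
    have "dependent ?S"
      using True by (intro dependent_biggerset) (auto simp: card_image)
    then obtain u where u: "(\<Sum>v\<in>?S. u v *\<^sub>R v) = 0" "\<exists>v\<in>?S. u v \<noteq> 0"
      using dependent_finite[of ?S] by auto
    then show ?thesis unfolding Q_def
      by (intro exI[of _ "\<lambda>i. u ((T ^^ i) x)"]) (auto simp: sum.reindex[OF True])
  next
    case False
    then obtain i j where ij: "i \<le> DIM('a)" "j \<le> DIM('a)" "i \<noteq> j" "(T ^^ i) x = (T ^^ j) x"
      by (auto simp: inj_on_def)
    let ?c = "\<lambda>k. (if k = i then 1 else 0) - (if k = j then 1 else (0::real))"
    have "(\<Sum>k\<le>DIM('a). ?c k *\<^sub>R (T ^^ k) x) = 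
      (\<Sum>k\<le>DIM('a). (if k = i then (T ^^ k) x else 0) - (if k = j then (T ^^ k) x else 0))"
      by (intro sum.cong) auto
    also have "\<dots> = 0"
      using ij by (simp add: sum_subtractf)
    finally show ?thesis unfolding Q_def using ij by (intro exI[of _ ?c]) auto
  qed
  define D where "D = (LEAST D. Q D)"
  have D: "Q D" "D \<le> DIM('a)" and min: "\<And>k. k < D \<Longrightarrow> \<not> Q k"
    unfolding D_def using \<open>Q DIM('a)\<close> by (auto intro: LeastI Least_le dest: not_less_Least)
  have ind: "\<forall>i<D. c i = 0" if "(\<Sum>i<D. c i *\<^sub>R (T ^^ i) x) = 0" for c
  proof (cases D)
    case (Suc k)
    with that have "(\<Sum>i\<le>k. c i *\<^sub>R (T ^^ i) x) = 0" by (simp add: lessThan_Suc_atMost)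
    with min[of k] Suc show ?thesis unfolding Q_def by (auto simp: less_Suc_eq_le)
  qed simp
  obtain c where c: "(\<Sum>i\<le>D. c i *\<^sub>R (T ^^ i) x) = 0" "\<exists>i\<le>D. c i \<noteq> 0"
    using D unfolding Q_def by auto
  have eq: "(\<Sum>i<D. c i *\<^sub>R (T ^^ i) x) + c D *\<^sub>R (T ^^ D) x = 0"
    using c(1) by (simp add: lessThan_Suc_atMost[symmetric])
  have "c D \<noteq> 0"
  proof
    assume "c D = 0"
    then have "\<forall>i<D. c i = 0" using ind eq by simp
    with \<open>c D = 0\<close> c(2) show False by (metis le_neq_implies_less)
  qed
  have "(T ^^ D) x = (\<Sum>i<D. (- c i / c D) *\<^sub>R (T ^^ i) x)"
  proof -
    have "c D *\<^sub>R (T ^^ D) x = - (\<Sum>i<D. c i *\<^sub>R (T ^^ i) x)"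
      using minus_unique[OF eq] by simp
    then have "(1 / c D) *\<^sub>R (c D *\<^sub>R (T ^^ D) x) = (1 / c D) *\<^sub>R (- (\<Sum>i<D. c i *\<^sub>R (T ^^ i) x))"
      by simp
    then show ?thesis using \<open>c D \<noteq> 0\<close>
      by (simp add: scaleR_sum_right sum_negf)
  qed
  then show ?thesis
    using D(2) ind by (intro that[of D "\<lambda>i. - c i / c D"]) simp_all
qed

text \<open>
  If \<open>q\<close> is the minimal polynomial of \<open>x\<close> and \<open>q = (X - z) g\<close>, then \<open>g(T) x\<close> is an eigenvector for
  \<open>z\<close>. It does not vanish because \<open>g\<close> is monic of smaller degree than \<open>q\<close>.
\<close>

lemma root_is_real_eigenpair:
  fixes T :: "'a::real_vector \<Rightarrow> 'a"
  assumes T: "linear T"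
    and rel: "(T ^^ D) x = (\<Sum>i<D. c i *\<^sub>R (T ^^ i) x)"
    and ind: "\<forall>c. (\<Sum>i<D. c i *\<^sub>R (T ^^ i) x) = 0 \<longrightarrow> (\<forall>i<D. c i = 0)"
    and q: "q = monom 1 D - (\<Sum>i<D. monom (c i) i)"
    and fac: "map_poly of_real q = [:-z, 1:] * g"
  shows "real_eigenpair T z"
proof -
  interpret T: linear T by fact
  define \<alpha> where "\<alpha> = (\<lambda>i. if i = D then 1 else if i < D then - c i else 0)"
  have q\<alpha>: "coeff q i = \<alpha> i" for i
    unfolding q \<alpha>_def by (auto simp: coeff_sum)
  have degq: "degree q = D" "q \<noteq> 0"
  proof -
    have "coeff q D = 1" by (simp add: q\<alpha> \<alpha>_def)
    moreover have "degree q \<le> D" by (rule degree_le) (auto simp: q\<alpha> \<alpha>_def)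
    ultimately show "degree q = D" "q \<noteq> 0" by (auto intro!: antisym le_degree)
  qed
  have "coeff (map_poly complex_of_real q) D = 1" by (simp add: coeff_map_poly q\<alpha> \<alpha>_def)
  then have [simp]: "g \<noteq> 0" unfolding fac by auto
  have "degree (map_poly (of_real :: real \<Rightarrow> complex) q) = D" using degq by (simp add: degree_map_poly)
  then have D: "D = Suc (degree g)" unfolding fac by (subst (asm) degree_mult_eq) auto
  have cf: "complex_of_real (\<alpha> i) = (if i = 0 then 0 else coeff g (i - 1)) - z * coeff g i" for i
  proof -
    have "complex_of_real (\<alpha> i) = coeff (map_poly of_real q) i" by (simp add: coeff_map_poly q\<alpha>)
    then show ?thesis unfolding fac by (cases i) (auto simp: algebra_simps)
  qed
  have gD: "coeff g D = 0" using D by (simp add: coeff_eq_0)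
  have lead: "coeff g (degree g) = 1" using cf[of D] gD D by (simp add: \<alpha>_def)
  have Re_g: "(if i = 0 then 0 else Re (coeff g (i - 1))) = \<alpha> i + Re z * Re (coeff g i) - Im z * Im (coeff g i)" for i
    using arg_cong[OF cf[of i], of Re] by (auto simp: algebra_simps)
  have Im_g: "(if i = 0 then 0 else Im (coeff g (i - 1))) = Im z * Re (coeff g i) + Re z * Im (coeff g i)" for i
    using arg_cong[OF cf[of i], of Im] by (auto simp: algebra_simps)
  define P where "P = (\<lambda>d. \<Sum>i\<le>D. d i *\<^sub>R (T ^^ i) x)"
  have zero: "P \<alpha> = 0"
    unfolding P_def lessThan_Suc_atMost[symmetric] sum.lessThan_Suc
    by (simp add: rel \<alpha>_def sum.distrib[symmetric])
  have shift: "T (P d) = P (\<lambda>i. if i = 0 then 0 else d (i - 1))" if "d D = 0" for d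
  proof -
    have "T (P d) = (\<Sum>i\<le>D. d i *\<^sub>R (T ^^ Suc i) x)"
      unfolding P_def by (simp add: T.sum T.scaleR)
    also have "\<dots> = (\<Sum>i<D. d i *\<^sub>R (T ^^ Suc i) x)"
      unfolding lessThan_Suc_atMost[symmetric] sum.lessThan_Suc using that by simp
    also have "\<dots> = P (\<lambda>i. if i = 0 then 0 else d (i - 1))"
      unfolding P_def D sum.atMost_Suc_shift by (simp add: lessThan_Suc_atMost)
    finally show ?thesis .
  qed
  define u where "u = P (\<lambda>i. Re (coeff g i))"
  define v where "v = P (\<lambda>i. Im (coeff g i))"
  have "T u = P (\<lambda>i. \<alpha> i + Re z * Re (coeff g i) - Im z * Im (coeff g i))"
    unfolding u_def by (subst shift) (simp_all add: gD Re_g)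
  also have "\<dots> = P \<alpha> + Re z *\<^sub>R u - Im z *\<^sub>R v"
    unfolding u_def v_def P_def
    by (simp add: scaleR_sum_right sum.distrib sum_subtractf scaleR_add_left scaleR_diff_left)
  finally have "T u = Re z *\<^sub>R u - Im z *\<^sub>R v" using zero by simp
  moreover have "T v = P (\<lambda>i. Im z * Re (coeff g i) + Re z * Im (coeff g i))"
    unfolding v_def by (subst shift) (simp_all add: gD Im_g)
  then have "T v = Im z *\<^sub>R u + Re z *\<^sub>R v"
    unfolding u_def v_def P_def
    by (simp add: scaleR_sum_right sum.distrib scaleR_add_left)
  moreover have "u \<noteq> 0"
  proof
    assume "u = 0"
    then have "(\<Sum>i<D. Re (coeff g i) *\<^sub>R (T ^^ i) x) = 0"
      unfolding u_def P_def lessThan_Suc_atMost[symmetric] sum.lessThan_Suc using gD by simp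
    from ind[rule_format, OF this, of "degree g"] D have "Re (coeff g (degree g)) = 0" by auto
    with lead show False by simp
  qed
  ultimately show ?thesis unfolding real_eigenpair_def by blast
qed

lemma is_normD:
  assumes "is_norm w"
  shows "0 \<le> w x" "w x = 0 \<longleftrightarrow> x = 0" "w (c *\<^sub>R x) = \<bar>c\<bar> * w x" "w (x + y) \<le> w x + w y"
  using assms by (simp_all add: is_norm_def)

lemma is_norm_sum_le:
  assumes "is_norm w"
  shows "w (sum f A) \<le> (\<Sum>i\<in>A. w (f i))"
proof (cases "finite A")
  case True
  then show ?thesis
  proof (induction rule: finite_induct)
    case empty
    then show ?case using is_normD(2)[OF assms, of 0] by simp
  next
    case (insert a F)
    have "w (f a + sum f F) \<le> w (f a) + w (sum f F)" by (rule is_normD(4)[OF assms])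
    then show ?case using insert by simp
  qed
next
  case False
  then show ?thesis using is_normD(2)[OF assms, of 0] by simp
qed

text \<open>
  Let \<open>q\<close> be the monic polynomial of least degree with \<open>q(T) x = 0\<close>. Its roots are eigenvalues of \<open>T\<close>,
  so \<open>\<bar>q(1)\<bar>\<close> is at least a power of \<open>1 - s\<close>, and its coefficients are bounded by a power of \<open>2\<close>. As \<open>T\<close> is a
  contraction, \<open>T ^^ i\<close> moves \<open>x\<close> by at most \<open>i e\<close>, so \<open>q(1) x = q(1) x - q(T) x\<close> has norm at most
  the sum of the moduli of the coefficients times the degree times \<open>e\<close>. No constant depends on \<open>T\<close>
  or on the norm.
\<close>

lemma almost_fixed_vector_bound:
  fixes T :: "'a::euclidean_space \<Rightarrow> 'a" and w :: "'a \<Rightarrow> real"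
  assumes T: "linear T" and w: "is_norm w"
    and contr: "\<And>y. w (T y) \<le> w y"
    and eig: "\<And>z. real_eigenpair T z \<Longrightarrow> norm z \<le> s" and s: "s < 1"
    and fixed: "w (T x - x) \<le> e"
  shows "(1 - s) ^ DIM('a) * w x \<le> 2 ^ DIM('a) * real DIM('a) * e"
proof -
  interpret T: linear T by fact
  note w0 = is_normD(1)[OF w] and wsc = is_normD(3)[OF w] and wtri = is_normD(4)[OF w]
  have wz: "w 0 = 0" using is_normD(2)[OF w, of 0] by simp
  have e: "e \<ge> 0" using fixed w0[of "T x - x"] by simp
  obtain D c where D: "D \<le> DIM('a)" and rel: "(T ^^ D) x = (\<Sum>i<D. c i *\<^sub>R (T ^^ i) x)"
    and ind: "\<forall>c. (\<Sum>i<D. c i *\<^sub>R (T ^^ i) x) = 0 \<longrightarrow> (\<forall>i<D. c i = 0)"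
    by (rule krylov_relation[of T x])
  show ?thesis
  proof (cases "D = 0")
    case True
    then have "x = 0" using rel by simp
    then show ?thesis using e by (simp add: wz)
  next
    case False
    define q where "q = monom 1 D - (\<Sum>i<D. monom (c i) i)"
    have cq: "coeff q i = (if i = D then 1 else if i < D then - c i else 0)" for i
      unfolding q_def by (auto simp: coeff_sum)
    have degq: "degree q = D"
      by (intro antisym le_degree degree_le) (auto simp: cq)
    let ?Q = "map_poly complex_of_real q"
    have "degree ?Q = D" by (simp add: degree_map_poly degq)
    moreover have "lead_coeff ?Q = 1" using \<open>degree ?Q = D\<close> by (simp add: coeff_map_poly cq)
    ultimately obtain R where R: "size R = D" "?Q = (\<Prod>z\<in>#R. [:-z, 1:])"
      using root_product_factorization[of ?Q] by auto
    have Rs: "norm z \<le> s" if z: "z \<in># R" for z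
    proof -
      obtain R' where "R = add_mset z R'" using z by (metis multi_member_split)
      then have "?Q = [:-z, 1:] * (\<Prod>z\<in>#R'. [:-z, 1:])" using R(2) by simp
      from root_is_real_eigenpair[OF T rel ind q_def this] show ?thesis by (rule eig)
    qed
    have s0: "0 \<le> s"
    proof -
      obtain z where "z \<in># R" using R(1) False by (cases R) auto
      from Rs[OF this] show ?thesis by (meson norm_ge_zero order_trans)
    qed
    have sumc: "(\<Sum>i\<le>D. \<bar>coeff q i\<bar>) \<le> 2 ^ D"
      using sum_norm_coeff_root_product_le[of R D] Rs s R(2)[symmetric] R(1)
      by (force simp: coeff_map_poly)
    have "(1 - s) ^ DIM('a) \<le> (1 - s) ^ D"
      using D s s0 by (intro power_decreasing) auto
    also have "\<dots> \<le> norm (poly ?Q 1)"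
      using norm_poly_root_product_ge[of R s] Rs s R by auto
    also have "poly ?Q 1 = of_real (poly q 1)"
      by (simp add: poly_altdef coeff_map_poly degree_map_poly)
    finally have "(1 - s) ^ DIM('a) \<le> \<bar>poly q 1\<bar>"
      by (simp only: norm_of_real)
    then have q1: "(1 - s) ^ DIM('a) \<le> \<bar>\<Sum>i\<le>D. coeff q i\<bar>"
      by (simp add: poly_altdef degq)
    have step: "w ((T ^^ i) x - x) \<le> real i * e" for i
    proof (induction i)
      case (Suc i)
      have *: "w ((T ^^ i) (T x) - (T ^^ i) x) \<le> w (T x - x)" 
      proof (induction i)
        case (Suc i)
        have "w ((T ^^ Suc i) (T x) - (T ^^ Suc i) x) = w (T ((T ^^ i) (T x) - (T ^^ i) x))"
          by (simp add: T.diff)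
        with contr[of "(T ^^ i) (T x) - (T ^^ i) x"] Suc show ?case by simp
      qed simp
      have "w ((T ^^ Suc i) x - x) \<le> w ((T ^^ i) (T x) - (T ^^ i) x) + w ((T ^^ i) x - x)"
        using wtri[of "(T ^^ i) (T x) - (T ^^ i) x" "(T ^^ i) x - x"] by (simp add: funpow_swap1)
      then show ?case using * fixed Suc by (simp add: algebra_simps)
    qed (simp add: wz)
    have zero: "(\<Sum>i\<le>D. coeff q i *\<^sub>R (T ^^ i) x) = 0"
      unfolding lessThan_Suc_atMost[symmetric] sum.lessThan_Suc
      by (simp add: rel cq sum.distrib[symmetric])
    have "\<bar>\<Sum>i\<le>D. coeff q i\<bar> * w x = w ((\<Sum>i\<le>D. - coeff q i) *\<^sub>R x)"
      using wsc[of "\<Sum>i\<le>D. - coeff q i" x] by (simp add: sum_negf)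
    also have "(\<Sum>i\<le>D. - coeff q i) *\<^sub>R x = (\<Sum>i\<le>D. coeff q i *\<^sub>R ((T ^^ i) x - x))"
      by (simp add: scaleR_diff_right sum_subtractf zero scaleR_sum_left sum_negf)
    also have "w \<dots> \<le> (\<Sum>i\<le>D. \<bar>coeff q i\<bar> * w ((T ^^ i) x - x))"
      using is_norm_sum_le[OF w, of "\<lambda>i. coeff q i *\<^sub>R ((T ^^ i) x - x)" "{..D}"] by (simp add: wsc)
    also have "\<dots> \<le> (\<Sum>i\<le>D. \<bar>coeff q i\<bar> * (real DIM('a) * e))"
    proof (intro sum_mono mult_left_mono)
      fix i assume "i \<in> {..D}"
      then have "real i * e \<le> real DIM('a) * e" using D e by (intro mult_right_mono) auto
      with step[of i] show "w ((T ^^ i) x - x) \<le> real DIM('a) * e" by linarith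
    qed auto
    also have "\<dots> = (\<Sum>i\<le>D. \<bar>coeff q i\<bar>) * (real DIM('a) * e)" by (simp add: sum_distrib_right)
    also have "\<dots> \<le> 2 ^ D * (real DIM('a) * e)" using sumc e by (intro mult_right_mono) auto
    also have "\<dots> \<le> 2 ^ DIM('a) * (real DIM('a) * e)"
      using D e by (intro mult_right_mono power_increasing) auto
    finally have "\<bar>\<Sum>i\<le>D. coeff q i\<bar> * w x \<le> 2 ^ DIM('a) * real DIM('a) * e" by simp
    moreover have "(1 - s) ^ DIM('a) * w x \<le> \<bar>\<Sum>i\<le>D. coeff q i\<bar> * w x"
      using q1 w0 by (intro mult_right_mono) auto
    ultimately show ?thesis by linarith
  qed
qed

section \<open>Norms on Euclidean spaces and on matrices\<close>

lemma norm_matrix_vector_le: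
  fixes A :: "real^'n^'n"
  shows "norm (A *v x) \<le> real CARD('n) ^ 2 * norm A * norm x"
proof -
  have "\<bar>A $ i $ j\<bar> \<le> norm A" for i j
    using component_le_norm_cart[of "A $ i" j] Finite_Cartesian_Product.norm_nth_le[of A i] by simp
  then have "onorm ((*v) A) \<le> real CARD('n) * real CARD('n) * norm A"
    by (rule onorm_le_matrix_component)
  then have "onorm ((*v) A) * norm x \<le> real CARD('n) * real CARD('n) * norm A * norm x"
    by (rule mult_right_mono) simp
  with onorm[OF matrix_vector_mul_bounded_linear, of A x] show ?thesis
    by (simp add: power2_eq_square)
qed

lemma norm_matrix_le:
  fixes A :: "real^'n^'n"
  assumes "\<And>x. norm (A *v x) \<le> c * norm x"
  shows "norm A \<le> real CARD('n) ^ 2 * c"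
proof -
  have "onorm ((*v) A) \<le> c" using assms by (rule onorm_le)
  then have c: "\<bar>A $ i $ j\<bar> \<le> c" for i j
    using matrix_component_le_onorm[of A i j] by linarith
  have "norm A \<le> (\<Sum>i\<in>UNIV. norm (A $ i))"
    by (simp add: norm_vec_def L2_set_le_sum)
  also have "\<dots> \<le> (\<Sum>i\<in>(UNIV::'n set). \<Sum>j\<in>(UNIV::'n set). c)"
    by (intro sum_mono order_trans[OF norm_le_l1_cart] c)
  finally show ?thesis by (simp add: power2_eq_square)
qed

lemma is_norm_le_norm:
  fixes w :: "'a::euclidean_space \<Rightarrow> real"
  assumes "is_norm w"
  obtains C where "C > 0" "\<And>x. w x \<le> C * norm x"
proof -
  note w = is_normD[OF assms]
  define C where "C = 1 + (\<Sum>b\<in>Basis. w b)"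
  have "w x \<le> C * norm x" for x
  proof -
    have "w x = w (\<Sum>b\<in>Basis. (x \<bullet> b) *\<^sub>R b)" by (simp add: euclidean_representation)
    also have "\<dots> \<le> (\<Sum>b\<in>Basis. w ((x \<bullet> b) *\<^sub>R b))" by (rule is_norm_sum_le[OF assms])
    also have "\<dots> \<le> (\<Sum>b\<in>Basis. norm x * w b)"
      unfolding w(3) by (intro sum_mono mult_right_mono w(1)) (simp add: Basis_le_norm)
    also have "\<dots> \<le> C * norm x"
      by (simp add: C_def sum_distrib_left algebra_simps)
    finally show ?thesis .
  qed
  moreover have "C > 0" using sum_nonneg[of Basis w] w(1) by (auto simp: C_def intro: add_pos_nonneg)
  ultimately show ?thesis using that by blast
qed

lemma is_norm_continuous:
  fixes w :: "'a::euclidean_space \<Rightarrow> real"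
  assumes "is_norm w"
  shows "continuous_on S w"
proof -
  note w = is_normD[OF assms]
  obtain C where C: "C > 0" "\<And>x. w x \<le> C * norm x" using is_norm_le_norm[OF assms] by blast
  have "\<bar>w x - w y\<bar> \<le> C * norm (x - y)" for x y
  proof -
    have "w x \<le> w (x - y) + w y" "w y \<le> w (y - x) + w x"
      using w(4)[of "x - y" y] w(4)[of "y - x" x] by simp_all
    with C(2)[of "x - y"] C(2)[of "y - x"] show ?thesis by (simp add: norm_minus_commute)
  qed
  then have "C-lipschitz_on S w"
    using C(1) by (intro lipschitz_onI) (auto simp: dist_norm)
  then show ?thesis by (rule lipschitz_on_continuous_on)
qed

lemma norm_le_is_norm:
  fixes w :: "'a::euclidean_space \<Rightarrow> real"
  assumes "is_norm w"
  obtains C where "C > 0" "\<And>x. norm x \<le> C * w x"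
proof -
  note w = is_normD[OF assms]
  have "compact (sphere (0::'a) 1)" "sphere (0::'a) 1 \<noteq> {}" by auto
  then obtain y where y: "y \<in> sphere 0 1" "\<And>z. z \<in> sphere 0 1 \<Longrightarrow> w y \<le> w z"
    using continuous_attains_inf[of "sphere (0::'a) 1" w] is_norm_continuous[OF assms] by blast
  have "y \<noteq> 0" using y(1) by auto
  then have pos: "w y > 0" using w(1)[of y] w(2)[of y] by linarith
  have "norm x \<le> (1 / w y) * w x" for x
  proof (cases "x = 0")
    case False
    then have "w y \<le> w ((1 / norm x) *\<^sub>R x)" by (intro y(2)) auto
    also have "\<dots> = w x / norm x" by (subst w(3)) simp
    finally show ?thesis using False pos by (simp add: field_simps)
  qed (simp add: w(1) pos)
  then show ?thesis using that[of "1 / w y"] pos by simp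
qed

text \<open>
  If the points were \<open>e\<close>-separated, the balls of radius \<open>e/2\<close> around them would be disjoint subsets
  of the ball of radius \<open>1 + e/2\<close>; comparing volumes bounds their number. The bound is the same for
  all norms, which matters because the norm in the Berger-Wang argument depends on the length of
  the trajectory.
\<close>

lemma is_norm_pigeonhole:
  fixes w :: "'a::euclidean_space \<Rightarrow> real" and x :: "nat \<Rightarrow> 'a"
  assumes w: "is_norm w" and e: "e > 0" and x: "\<And>i. i \<le> L \<Longrightarrow> w (x i) \<le> 1"
    and L: "((2 + e) / e) ^ DIM('a) \<le> real L"
  shows "\<exists>i j. i < j \<and> j \<le> L \<and> w (x i - x j) < e"
proof (rule ccontr)
  assume contra: "\<not> ?thesis"
  note wD = is_normD[OF w]
  have wneg: "w (a - b) = w (b - a)" for a b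
    using wD(3)[of "-1" "a - b"] by simp
  have sep: "w (x i - x j) \<ge> e" if "i \<le> L" "j \<le> L" "i \<noteq> j" for i j
    using contra that wneg[of "x i" "x j"] by (metis linorder_neqE_nat not_le)
  define B where "B = {y. w y < 1}"
  have "open B"
    using open_Collect_less[of w "\<lambda>_. 1"] is_norm_continuous[OF w] unfolding B_def by auto
  obtain C where C: "C > 0" "\<And>x. norm x \<le> C * w x" using norm_le_is_norm[OF w] by blast
  have "B \<subseteq> ball 0 C"
  proof
    fix y assume "y \<in> B"
    then have "C * w y < C * 1" unfolding B_def using C(1) by (intro mult_strict_left_mono) auto
    with C(2)[of y] show "y \<in> ball 0 C" by simp
  qed
  then have "bounded B" using bounded_ball bounded_subset by blast
  have lm: "S \<in> lmeasurable" if "open S" "bounded S" for S :: "'a set"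
    using that by (rule lmeasurable_open[rotated])
  have "0 \<in> B" using wD(2)[of 0] by (simp add: B_def)
  have mB: "measure lebesgue B > 0"
  proof -
    obtain r where r: "r > 0" "ball 0 r \<subseteq> B" using \<open>open B\<close> \<open>0 \<in> B\<close> open_contains_ball by blast
    have "measure lebesgue (ball (0::'a) r) > 0" using r(1) by (simp add: content_ball_pos)
    also have "\<dots> \<le> measure lebesgue B"
      using r(2) lm[OF \<open>open B\<close> \<open>bounded B\<close>] by (intro measure_mono_fmeasurable) auto
    finally show ?thesis .
  qed
  have aff: "open ((\<lambda>y. c *\<^sub>R y + d) ` B)" "bounded ((\<lambda>y. c *\<^sub>R y + d) ` B)" if "c > 0" for c and d :: 'a
  proof -
    have "(\<lambda>y. c *\<^sub>R y + d) ` B = (+) d ` ((*\<^sub>R) c ` B)" by (auto simp: image_image add.commute)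
    then show "open ((\<lambda>y. c *\<^sub>R y + d) ` B)" "bounded ((\<lambda>y. c *\<^sub>R y + d) ` B)"
      using that \<open>open B\<close> \<open>bounded B\<close> by (auto simp: open_scaling open_translation bounded_translation bounded_scaling)
  qed
  define V where "V = (\<lambda>i. (\<lambda>y. (e/2) *\<^sub>R y + x i) ` B)"
  have Vw: "w (y - x i) < e / 2" if "y \<in> V i" for y i
  proof -
    obtain b where "y = (e/2) *\<^sub>R b + x i" "w b < 1" using \<open>y \<in> V i\<close> by (auto simp: V_def B_def)
    then show ?thesis using e by (simp add: wD(3))
  qed
  have disj: "disjoint_family_on V {..L}"
  unfolding disjoint_family_on_def
  proof (intro ballI impI)
    fix i j assume ij: "i \<in> {..L}" "j \<in> {..L}" "i \<noteq> j"
    show "V i \<inter> V j = {}"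
    proof (rule ccontr)
      assume "V i \<inter> V j \<noteq> {}"
      then obtain y where "y \<in> V i" "y \<in> V j" by blast
      from Vw[OF this(1)] Vw[OF this(2)] have "w (x i - y) + w (y - x j) < e"
        by (simp add: wneg[of "x i" y])
      with wD(4)[of "x i - y" "y - x j"] sep[of i j] ij show False by simp
    qed
  qed
  have Vm: "V i \<in> lmeasurable" for i unfolding V_def using e by (intro lm aff) auto
  have mV: "measure lebesgue (V i) = (e/2) ^ DIM('a) * measure lebesgue B" for i
    unfolding V_def using e by (subst measure_lebesgue_affine) auto
  have sub: "(\<Union>i\<in>{..L}. V i) \<subseteq> (\<lambda>y. (1 + e/2) *\<^sub>R y + 0) ` B"
  proof
    fix y assume "y \<in> (\<Union>i\<in>{..L}. V i)"
    then obtain i where i: "i \<le> L" "y \<in> V i" by auto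
    have "w y \<le> w (y - x i) + w (x i)" using wD(4)[of "y - x i" "x i"] by simp
    also have "\<dots> < 1 + e/2" using Vw[OF i(2)] x[OF i(1)] by simp
    finally have "w ((1 / (1 + e/2)) *\<^sub>R y) < 1"
      using e by (subst wD(3)) (simp add: field_simps)
    then have "(1 / (1 + e/2)) *\<^sub>R y \<in> B" by (simp add: B_def)
    moreover have "y = (1 + e/2) *\<^sub>R ((1 / (1 + e/2)) *\<^sub>R y) + 0" using e by simp
    ultimately show "y \<in> (\<lambda>y. (1 + e/2) *\<^sub>R y + 0) ` B" by blast
  qed
  have "real (Suc L) * ((e/2) ^ DIM('a) * measure lebesgue B) = (\<Sum>i\<le>L. measure lebesgue (V i))"
    by (simp add: mV)
  also have "\<dots> = measure lebesgue (\<Union>i\<in>{..L}. V i)"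
    using disj fmeasurableD[OF Vm] fmeasurableD2[OF Vm]
    by (intro measure_finite_Union[symmetric]) (auto simp del: emeasure_completion)
  also have "\<dots> \<le> measure lebesgue ((\<lambda>y. (1 + e/2) *\<^sub>R y + 0) ` B)"
    using e Vm by (intro measure_mono_fmeasurable[OF sub] lm aff sets.finite_UN) auto
  also have "\<dots> = (1 + e/2) ^ DIM('a) * measure lebesgue B"
    using e by (subst measure_lebesgue_affine) auto
  finally have "real (Suc L) * (e/2) ^ DIM('a) \<le> (1 + e/2) ^ DIM('a)"
    using mB by (simp add: mult.assoc[symmetric])
  also have "(1 + e/2) ^ DIM('a) = ((2 + e) / e) ^ DIM('a) * (e/2) ^ DIM('a)"
  proof -
    have "1 + e/2 = ((2 + e) / e) * (e/2)" using e by (simp add: field_simps)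
    then show ?thesis by (metis power_mult_distrib)
  qed
  finally have "real (Suc L) \<le> ((2 + e) / e) ^ DIM('a)"
    using e by (simp add: mult_le_cancel_right)
  with L show False by simp
qed

section \<open>The Berger-Wang bound for a bounded set of matrices\<close>

lemma mat_prod_add:
  "mat_prod B (m + n) = mat_prod (\<lambda>i. B (i + m)) n ** mat_prod B m"
  by (induction n) (simp_all add: matrix_mul_assoc add.commute)

lemma mat_prod_mv_add:
  "mat_prod B (m + n) *v x = mat_prod (\<lambda>i. B (i + m)) n *v (mat_prod B m *v x)"
  by (simp add: mat_prod_add matrix_vector_mul_assoc)

text \<open>
  Under a growth bound with rate \<open>l\<close> the supremum \<open>w\<close> of the rescaled orbits is a norm in which every
  matrix of \<open>G\<close> has operator norm at most \<open>l\<close>.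
\<close>

locale bounded_products =
  fixes G :: "(real^'n^'n) set" and l C :: real
  assumes ne: "G \<noteq> {}" and l: "0 < l" and C: "0 \<le> C"
    and bd: "\<And>k B x. (\<forall>i. B i \<in> G) \<Longrightarrow> norm (mat_prod B k *v x) \<le> C * l ^ k * norm x"
begin

definition w :: "real^'n \<Rightarrow> real" where
  "w x = (SUP p\<in>{B. \<forall>i. B i \<in> G} \<times> UNIV. norm (mat_prod (fst p) (snd p) *v x) / l ^ snd p)"

lemma orbit_le: "norm (mat_prod B k *v x) / l ^ k \<le> C * norm x" if "\<forall>i. B i \<in> G"
  using bd[OF that, of k x] l by (simp add: field_simps)

lemma le_w: "norm (mat_prod B k *v x) / l ^ k \<le> w x" if "\<forall>i. B i \<in> G"
proof -
  have "bdd_above ((\<lambda>p. norm (mat_prod (fst p) (snd p) *v x) / l ^ snd p) ` ({B. \<forall>i. B i \<in> G} \<times> UNIV))"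
    using orbit_le by (intro bdd_aboveI2[of _ _ "C * norm x"]) auto
  from cSUP_upper[OF _ this, of "(B, k)"] show ?thesis unfolding w_def using that by simp
qed

lemma w_le: "w x \<le> c" if "\<And>B k. \<forall>i. B i \<in> G \<Longrightarrow> norm (mat_prod B k *v x) / l ^ k \<le> c"
proof -
  obtain A where "A \<in> G" using ne by blast
  then have "(\<lambda>_. A, 0) \<in> {B. \<forall>i. B i \<in> G} \<times> UNIV" by simp
  then show ?thesis unfolding w_def using that by (intro cSUP_least) auto
qed

lemma norm_le_w: "norm x \<le> w x"
proof -
  obtain A where "A \<in> G" using ne by blast
  with le_w[of "\<lambda>_. A" 0 x] show ?thesis by simp
qed

lemma w_le_norm: "w x \<le> C * norm x"
  by (rule w_le) (rule orbit_le)

lemma is_norm_w: "is_norm w"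
proof -
  have scale_le: "w (c *\<^sub>R x) \<le> \<bar>c\<bar> * w x" for c x
  proof (rule w_le)
    fix B :: "nat \<Rightarrow> real^'n^'n" and k assume B: "\<forall>i. B i \<in> G"
    have "norm (mat_prod B k *v (c *\<^sub>R x)) / l ^ k = \<bar>c\<bar> * (norm (mat_prod B k *v x) / l ^ k)"
      by (simp add: matrix_vector_mult_scaleR)
    also have "\<dots> \<le> \<bar>c\<bar> * w x" using le_w[OF B] by (intro mult_left_mono) auto
    finally show "norm (mat_prod B k *v (c *\<^sub>R x)) / l ^ k \<le> \<bar>c\<bar> * w x" .
  qed
  have w0: "w 0 = 0" using w_le_norm[of 0] norm_le_w[of 0] by simp
  have "w (c *\<^sub>R x) = \<bar>c\<bar> * w x" for c x
  proof (cases "c = 0")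
    case False
    have "w x \<le> \<bar>inverse c\<bar> * w (c *\<^sub>R x)"
      using scale_le[of "inverse c" "c *\<^sub>R x"] False by simp
    then have "\<bar>c\<bar> * w x \<le> w (c *\<^sub>R x)" using False by (simp add: field_simps)
    with scale_le[of c x] show ?thesis by simp
  qed (simp add: w0)
  moreover have "w (x + y) \<le> w x + w y" for x y
  proof (rule w_le)
    fix B :: "nat \<Rightarrow> real^'n^'n" and k assume B: "\<forall>i. B i \<in> G"
    have "norm (mat_prod B k *v (x + y)) / l ^ k \<le> (norm (mat_prod B k *v x) + norm (mat_prod B k *v y)) / l ^ k"
      using l by (intro divide_right_mono) (auto simp: matrix_vector_right_distrib norm_triangle_ineq)
    also have "\<dots> \<le> w x + w y"
      using le_w[OF B, of k x] le_w[OF B, of k y] by (simp add: add_divide_distrib)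
    finally show "norm (mat_prod B k *v (x + y)) / l ^ k \<le> w x + w y" .
  qed
  moreover have "0 \<le> w x" for x using norm_le_w[of x] norm_ge_zero[of x] by linarith
  moreover have "w x = 0 \<longleftrightarrow> x = 0" for x
    using norm_le_w[of x] w0 by auto
  ultimately show ?thesis by (simp add: is_norm_def)
qed

lemma w_matrix: "w (A *v x) \<le> l * w x" if A: "A \<in> G"
proof (rule w_le)
  fix B :: "nat \<Rightarrow> real^'n^'n" and k assume B: "\<forall>i. B i \<in> G"
  define B' where "B' = (\<lambda>i. if i = 1 then A else B (i - 1))"
  have B': "\<forall>i. B' i \<in> G" using A B by (simp add: B'_def)
  have "mat_prod (\<lambda>i. B' (i + 1)) k = mat_prod B k" by (rule mat_prod_cong) (simp add: B'_def)
  then have "mat_prod B' (1 + k) *v x = mat_prod B k *v (A *v x)"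
    unfolding mat_prod_mv_add by (simp add: B'_def)
  with le_w[OF B', of "1 + k" x] l show "norm (mat_prod B k *v (A *v x)) / l ^ k \<le> l * w x"
    by (simp add: field_simps)
qed

lemma w_mat_prod: "w (mat_prod B k *v x) \<le> l ^ k * w x" if B: "\<forall>i. B i \<in> G"
proof (induction k)
  case (Suc k)
  have "w (mat_prod B (Suc k) *v x) \<le> l * w (mat_prod B k *v x)"
    using w_matrix[of "B (Suc k)" "mat_prod B k *v x"] B by (simp add: matrix_vector_mul_assoc)
  also have "\<dots> \<le> l * (l ^ k * w x)" using Suc l by simp
  finally show ?case by simp
qed simp

end

text \<open>
  One half of the theorem of Berger and Wang: if the eigenvalues of all products of length \<open>k\<close> are
  bounded by \<open>s ^ k\<close>, then the norms of the products grow with rate at most \<open>s\<close>. Let \<open>\<rho>\<close> be the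
  infimum of all admissible rates and suppose \<open>s < \<rho>\<close>. The proof works with the rates \<open>l\<close> and \<open>\<tau>\<close>
  slightly above and slightly below \<open>\<rho>\<close>, chosen so that \<open>(\<tau> / l) ^ L > 1/2\<close>. As \<open>\<tau>\<close> is not an
  admissible rate, some product of length \<open>L\<close> stretches a vector by more than \<open>\<tau> ^ L\<close>, and its
  trajectory then loses at most half of its rescaled norm.
\<close>

lemma Berger_Wang_bound:
  fixes G :: "(real^'n^'n) set"
  assumes ne: "G \<noteq> {}" and bdd: "bounded G" and s: "0 < s" and st: "s < t"
    and eig: "\<And>k B z. 1 \<le> k \<Longrightarrow> \<forall>i. B i \<in> G \<Longrightarrow> real_eigenpair ((*v) (mat_prod B k)) z \<Longrightarrow> norm z \<le> s ^ k"
  shows "\<exists>C\<ge>0. \<forall>k B x. (\<forall>i. B i \<in> G) \<longrightarrow> norm (mat_prod B k *v x) \<le> C * t ^ k * norm x"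
proof (rule ccontr)
  define Q where "Q = (\<lambda>t. 0 < t \<and> (\<exists>C\<ge>0. \<forall>k B x. (\<forall>i. B i \<in> G) \<longrightarrow> norm (mat_prod B k *v x) \<le> C * t ^ k * norm x))"
  assume "\<not> ?thesis"
  then have nQt: "\<not> Q t" by (simp add: Q_def)
  have up: "Q b" if "Q a" "a \<le> b" for a b
  proof -
    obtain C where a: "0 < a" and C: "C \<ge> 0"
      "\<And>k B x. (\<forall>i. B i \<in> G) \<Longrightarrow> norm (mat_prod B k *v x) \<le> C * a ^ k * norm x"
      using \<open>Q a\<close> unfolding Q_def by blast
    have "norm (mat_prod B k *v x) \<le> C * b ^ k * norm x" if B: "\<forall>i. B i \<in> G" for k B x
    proof -
      have "C * a ^ k * norm x \<le> C * b ^ k * norm x"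
        using a C(1) \<open>a \<le> b\<close> by (intro mult_right_mono mult_left_mono power_mono) auto
      with C(2)[OF B, of k x] show ?thesis by linarith
    qed
    then show ?thesis using a C(1) \<open>a \<le> b\<close> unfolding Q_def by (intro conjI exI[of _ C]) auto
  qed
  obtain b where "0 < b" and b: "\<And>A. A \<in> G \<Longrightarrow> norm A \<le> b"
    using bdd by (auto simp: bounded_pos)
  define b' where "b' = real CARD('n) ^ 2 * b"
  have b'0: "b' > 0" using \<open>0 < b\<close> by (simp add: b'_def)
  have Qb: "Q b'"
  proof -
    have "norm (mat_prod B k *v x) \<le> 1 * b' ^ k * norm x" if B: "\<forall>i. B i \<in> G" for k B x
    proof (induction k)
      case (Suc k)
      have "norm (mat_prod B (Suc k) *v x) \<le> real CARD('n) ^ 2 * norm (B (Suc k)) * norm (mat_prod B k *v x)"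
        using norm_matrix_vector_le[of "B (Suc k)" "mat_prod B k *v x"] by (simp add: matrix_vector_mul_assoc)
      also have "\<dots> \<le> b' * (1 * b' ^ k * norm x)"
        unfolding b'_def[symmetric] using b[of "B (Suc k)"] B b'0 Suc
        by (intro mult_mono) (auto simp: b'_def)
      finally show ?case by simp
    qed simp
    then show ?thesis unfolding Q_def using b'0 by (intro conjI exI[of _ 1]) auto
  qed
  define \<rho> where "\<rho> = Inf {t. Q t}"
  have gt: "t < a" if "Q a" for a using up[OF that, of t] nQt by force
  have \<rho>1: "t \<le> \<rho>" unfolding \<rho>_def using Qb gt by (intro cInf_greatest) (auto intro: less_imp_le)
  have \<rho>2: "\<rho> \<le> a" if "Q a" for a
    unfolding \<rho>_def using that gt by (intro cInf_lower bdd_belowI[of _ t]) (auto intro: less_imp_le)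
  have \<rho>0: "0 < \<rho>" and s\<rho>: "s < \<rho>" using s st \<rho>1 by auto
  define \<sigma> where "\<sigma> = s / \<rho>"
  have \<sigma>: "0 < \<sigma>" "\<sigma> < 1" using s s\<rho> \<rho>0 by (auto simp: \<sigma>_def)
  let ?d = "DIM(real^'n)"
  \<comment> \<open>Small enough to contradict \<open>almost_fixed_vector_bound\<close> for a vector of norm at least \<open>1/2\<close>.\<close>
  define e where "e = (1 - \<sigma>) ^ ?d / (4 * (2 ^ ?d * real ?d))"
  have e: "e > 0" unfolding e_def using \<sigma> by (intro divide_pos_pos) (auto simp: DIM_positive)
  have e2: "2 ^ ?d * real ?d * e < (1 - \<sigma>) ^ ?d / 2"
    unfolding e_def using \<sigma> by (simp add: field_simps)
  obtain L0 where L0: "((2 + e) / e) ^ ?d \<le> real L0" using real_arch_simple by blast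
  define L where "L = Suc L0"
  have L: "((2 + e) / e) ^ ?d \<le> real L" "L > 0" using L0 by (auto simp: L_def)
  \<comment> \<open>The ratio between the rates: \<open>l < \<rho> q\<close> and \<open>\<tau> = \<rho> / q\<close> give \<open>(\<tau> / l) ^ L > q ^ (-2 L) = 1/2\<close>.\<close>
  define q :: real where "q = 2 powr (1 / (2 * real L))"
  have q1: "q > 1" unfolding q_def using L(2) by (intro gr_one_powr) auto
  have q2: "q ^ (2 * L) = 2"
    unfolding q_def using L(2) by (simp add: powr_realpow[symmetric] powr_powr)
  have "\<rho> < \<rho> * q" using \<rho>0 q1 by simp
  then obtain l where lQ: "Q l" "l < \<rho> * q"
    using cInf_lessD[of "{t. Q t}" "\<rho> * q"] Qb unfolding \<rho>_def[symmetric] by auto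
  have \<rho>l: "\<rho> \<le> l" using \<rho>2 lQ by simp
  obtain C where l0: "0 < l" and C: "C \<ge> 0"
      "\<And>k B x. (\<forall>i. B i \<in> G) \<Longrightarrow> norm (mat_prod B k *v x) \<le> C * l ^ k * norm x"
    using lQ(1) unfolding Q_def by blast
  interpret bounded_products G l C
    by unfold_locales (use ne l0 C in auto)
  note wD = is_normD[OF is_norm_w]
  define \<tau> where "\<tau> = \<rho> / q"
  have \<tau>0: "0 < \<tau>" and \<tau>l: "\<tau> \<le> l"
    using \<rho>0 q1 \<rho>l by (auto simp: \<tau>_def field_simps intro: order_trans[of _ \<rho>] mult_mono)
      (metis l0 less_eq_real_def mult_le_cancel_left1 not_less order_trans)
  have "\<exists>B x. (\<forall>i. B i \<in> G) \<and> w (mat_prod B L *v x) > \<tau> ^ L * w x"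
  proof (rule ccontr)
    assume "\<not> ?thesis"
    then have step: "w (mat_prod B L *v x) \<le> \<tau> ^ L * w x" if "\<forall>i. B i \<in> G" for B x
      using that by (meson not_less)
    have blocks: "w (mat_prod B (n * L) *v x) \<le> \<tau> ^ (n * L) * w x" if B: "\<forall>i. B i \<in> G" for B x n
    proof (induction n)
      case (Suc n)
      have "w (mat_prod B (n * L + L) *v x) \<le> \<tau> ^ L * w (mat_prod B (n * L) *v x)"
        unfolding mat_prod_mv_add using B by (intro step) auto
      also have "\<dots> \<le> \<tau> ^ L * (\<tau> ^ (n * L) * w x)" using Suc \<tau>0 by (intro mult_left_mono) auto
      finally show ?case by (simp add: power_add algebra_simps)
    qed simp
    have "norm (mat_prod B k *v x) \<le> ((l / \<tau>) ^ L * C) * \<tau> ^ k * norm x" if B: "\<forall>i. B i \<in> G" for k B x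
    proof -
      define n m where "n = k div L" and "m = k mod L"
      have k: "k = n * L + m" and m: "m \<le> L" using L(2) by (auto simp: n_def m_def less_imp_le)
      have "norm (mat_prod B k *v x) \<le> w (mat_prod B k *v x)" by (rule norm_le_w)
      also have "\<dots> \<le> l ^ m * w (mat_prod B (n * L) *v x)"
        unfolding k mat_prod_mv_add using B by (intro w_mat_prod) auto
      also have "\<dots> \<le> l ^ m * (\<tau> ^ (n * L) * w x)"
        using blocks[OF B] l0 by (intro mult_left_mono) auto
      also have "\<dots> = (l / \<tau>) ^ m * \<tau> ^ k * w x"
        unfolding k using \<tau>0 by (simp add: power_add field_simps)
      also have "(l / \<tau>) ^ m \<le> (l / \<tau>) ^ L"
        using \<tau>0 \<tau>l m by (intro power_increasing) auto
      then have "(l / \<tau>) ^ m * \<tau> ^ k * w x \<le> (l / \<tau>) ^ L * \<tau> ^ k * (C * norm x)"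
        using \<tau>0 l0 w_le_norm[of x] wD(1)[of x] by (intro mult_mono) auto
      finally show ?thesis by (simp add: algebra_simps)
    qed
    then have "Q \<tau>" unfolding Q_def using \<tau>0 l0 C(1) by (intro conjI exI[of _ "(l / \<tau>) ^ L * C"]) auto
    from \<rho>2[OF this] show False using \<rho>0 q1 by (simp add: \<tau>_def field_simps)
  qed
  then obtain B x where B: "\<forall>i. B i \<in> G" and Bx: "w (mat_prod B L *v x) > \<tau> ^ L * w x" by blast
  have wx: "w x > 0"
  proof -
    have "x \<noteq> 0"
    proof
      assume "x = 0"
      then show False using Bx wD(2)[of 0] by simp
    qed
    then show ?thesis using wD(1)[of x] wD(2)[of x] by linarith
  qed
  define y where "y = (\<lambda>i. (1 / (l ^ i * w x)) *\<^sub>R (mat_prod B i *v x))"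
  have wy: "w (y i) = w (mat_prod B i *v x) / (l ^ i * w x)" for i
    unfolding y_def using wx l0 by (subst wD(3)) simp
  have y1: "w (y i) \<le> 1" for i
    unfolding wy using w_mat_prod[OF B, of i x] wx l0 by (simp add: field_simps)
  have T: "(1 / l ^ (j - i)) *\<^sub>R (mat_prod (\<lambda>k. B (k + i)) (j - i) *v (y i)) = y j" if "i \<le> j" for i j
  proof -
    have "mat_prod B j *v x = mat_prod (\<lambda>k. B (k + i)) (j - i) *v (mat_prod B i *v x)"
      using mat_prod_mv_add[of B i "j - i" x] that by simp
    moreover have "l ^ j = l ^ (j - i) * l ^ i" using that by (simp add: power_add[symmetric])
    ultimately show ?thesis unfolding y_def by (simp add: matrix_vector_mult_scaleR mult.assoc)
  qed
  have contr: "w ((1 / l ^ k) *\<^sub>R (mat_prod B k *v v)) \<le> w v" if "\<forall>i. B i \<in> G" for B k v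
    using w_mat_prod[OF that, of k v] l0 by (subst wD(3)) (simp add: field_simps)
  have yL: "w (y L) > 1 / 2"
  proof -
    have "(1 / q ^ 2) ^ L = 1 / 2" using q2 by (simp add: power_divide power_mult[symmetric])
    moreover have "1 / q ^ 2 \<le> \<tau> / l"
      using lQ(2) l0 q1 \<rho>0 by (simp add: \<tau>_def field_simps power2_eq_square)
    then have "(1 / q ^ 2) ^ L \<le> (\<tau> / l) ^ L" using q1 by (intro power_mono) auto
    moreover have "(\<tau> / l) ^ L < w (y L)"
      unfolding wy using Bx wx l0 by (simp add: field_simps)
    ultimately show ?thesis by linarith
  qed
  have "\<exists>i j. i < j \<and> j \<le> L \<and> w (y i - y j) < e"
    by (rule is_norm_pigeonhole[OF is_norm_w e _ L(1)]) (rule y1)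
  then obtain i j where ij: "i < j" "j \<le> L" "w (y i - y j) < e" by auto
  define T where "T = (\<lambda>v. (1 / l ^ (j - i)) *\<^sub>R (mat_prod (\<lambda>k. B (k + i)) (j - i) *v v))"
  have Ty: "T (y i) = y j" unfolding T_def using T[of i j] ij by simp
  have linT: "linear T" unfolding T_def
    by (intro linearI) (simp_all add: matrix_vector_right_distrib matrix_vector_mult_scaleR scaleR_add_right)
  have "(1 - \<sigma>) ^ ?d * w (y i) \<le> 2 ^ ?d * real ?d * e"
  proof (rule almost_fixed_vector_bound[OF linT is_norm_w])
    show "w (T v) \<le> w v" for v unfolding T_def using B by (intro contr) auto
    show "w (T (y i) - y i) \<le> e"
      using ij(3) wD(3)[of "-1" "y i - y j"] by (simp add: Ty)
    show "norm z \<le> \<sigma>" if z: "real_eigenpair T z" for z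
    proof -
      let ?l = "l ^ (j - i)" and ?M = "mat_prod (\<lambda>k. B (k + i)) (j - i)"
      obtain u v where uv: "u \<noteq> 0 \<or> v \<noteq> 0" "T u = Re z *\<^sub>R u - Im z *\<^sub>R v" "T v = Im z *\<^sub>R u + Re z *\<^sub>R v"
        using z[unfolded real_eigenpair_def] by (elim exE conjE) (rule that)
      have MT: "?M *v a = ?l *\<^sub>R T a" for a unfolding T_def using l0 by simp
      have "real_eigenpair ((*v) ?M) (of_real ?l * z)"
        unfolding real_eigenpair_def using uv
        by (intro exI[of _ u] exI[of _ v]) (auto simp: MT scaleR_diff_right scaleR_add_right Re_power_real)
      from eig[OF _ _ this] ij B have "norm (of_real ?l * z) \<le> s ^ (j - i)" by auto
      then have "?l * norm z \<le> s ^ (j - i)" using l0 by (simp add: norm_mult norm_power)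
      then have "norm z \<le> (s / l) ^ (j - i)" using l0 by (simp add: field_simps power_divide)
      also have "\<dots> \<le> (s / l) ^ 1"
        using s l0 s\<rho> \<rho>l ij by (intro power_decreasing) auto
      also have "\<dots> \<le> \<sigma>" unfolding \<sigma>_def using s \<rho>0 \<rho>l by (simp add: frac_le)
      finally show ?thesis .
    qed
  qed (use \<sigma> in auto)
  moreover have "w (y L) \<le> w (y i)"
    using contr[of "\<lambda>k. B (k + i)" "L - i" "y i"] T[of i L] B ij by simp
  then have "(1 - \<sigma>) ^ ?d * (1 / 2) \<le> (1 - \<sigma>) ^ ?d * w (y i)"
    using yL \<sigma> by (intro mult_left_mono) auto
  ultimately show False using e2 by simp
qed

section \<open>Proper cones and Perron eigenvectors\<close>

lemma proper_coneD:
  assumes "proper_cone K"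
  shows "closed K" "convex K" "\<And>x t. x \<in> K \<Longrightarrow> 0 \<le> t \<Longrightarrow> t *\<^sub>R x \<in> K"
    "\<And>x y. x \<in> K \<Longrightarrow> y \<in> K \<Longrightarrow> x + y \<in> K" "\<And>x. x \<in> K \<Longrightarrow> - x \<in> K \<Longrightarrow> x = 0"
    "interior K \<noteq> {}"
proof -
  show "closed K" "convex K" "\<And>x t. x \<in> K \<Longrightarrow> 0 \<le> t \<Longrightarrow> t *\<^sub>R x \<in> K"
    "\<And>x. x \<in> K \<Longrightarrow> - x \<in> K \<Longrightarrow> x = 0" "interior K \<noteq> {}"
    using assms by (auto simp: proper_cone_def cone_def)
  show "\<And>x y. x \<in> K \<Longrightarrow> y \<in> K \<Longrightarrow> x + y \<in> K"
    using assms convex_cone[of K] by (auto simp: proper_cone_def)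
qed

text \<open>
  A pointed closed cone has a compact convex base that misses the origin: the convex hull of its unit
  vectors lies in \<open>K - {0}\<close>, which is convex. Separation from the origin gives the functional.
\<close>

lemma proper_cone_functional:
  fixes K :: "'a::euclidean_space set"
  assumes K: "proper_cone K"
  obtains a c where "c > 0" "\<And>x. x \<in> K \<Longrightarrow> c * norm x \<le> a \<bullet> x"
proof -
  note KD = proper_coneD[OF K]
  let ?S = "convex hull (K \<inter> sphere 0 1)"
  have "compact (K \<inter> sphere 0 1)" using KD(1) by (intro closed_Int_compact) auto
  then have "closed ?S" by (intro compact_imp_closed compact_convex_hull)
  moreover have "convex (K - {0})"
  proof (rule convexI)
    fix x y :: 'a and s t :: real
    assume xy: "x \<in> K - {0}" "y \<in> K - {0}" "0 \<le> s" "0 \<le> t" "s + t = 1"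
    then have "s *\<^sub>R x \<in> K" "t *\<^sub>R y \<in> K" by (auto intro: KD(3))
    moreover have "s *\<^sub>R x + t *\<^sub>R y \<noteq> 0"
    proof
      assume 0: "s *\<^sub>R x + t *\<^sub>R y = 0"
      then have "t *\<^sub>R y = - (s *\<^sub>R x)" by (metis add.commute eq_neg_iff_add_eq_0)
      then have "s *\<^sub>R x = 0" using KD(5)[of "s *\<^sub>R x"] \<open>s *\<^sub>R x \<in> K\<close> \<open>t *\<^sub>R y \<in> K\<close> by simp
      then show False using 0 xy by auto
    qed
    ultimately show "s *\<^sub>R x + t *\<^sub>R y \<in> K - {0}" using KD(4) by auto
  qed
  then have "?S \<subseteq> K - {0}" by (rule hull_minimal[rotated]) auto
  ultimately obtain a b where ab: "b > 0" "\<And>x. x \<in> ?S \<Longrightarrow> a \<bullet> x > b"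
    using separating_hyperplane_closed_0[of ?S] convex_convex_hull by blast
  have "b * norm x \<le> a \<bullet> x" if "x \<in> K" for x
  proof (cases "x = 0")
    case False
    have "(1 / norm x) *\<^sub>R x \<in> K \<inter> sphere 0 1" using False KD(3)[OF that, of "1 / norm x"] by simp
    then have "a \<bullet> ((1 / norm x) *\<^sub>R x) > b" by (intro ab hull_inc)
    then show ?thesis using False by (simp add: field_simps)
  qed simp
  then show ?thesis using that ab(1) by blast
qed

text \<open>
  The quantitative data of a proper cone: a functional \<open>a\<close> that is uniformly positive on \<open>K\<close> and an
  interior point \<open>u\<close> with room \<open>r\<close>.
\<close>

locale cone_frame =
  fixes K :: "'a::euclidean_space set" and a u :: 'a and c r :: real
  assumes K: "proper_cone K" and c: "c > 0" and r: "r > 0"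
    and a: "\<And>x. x \<in> K \<Longrightarrow> c * norm x \<le> a \<bullet> x"
    and u: "\<And>y. norm y \<le> r \<Longrightarrow> u + y \<in> K"
begin

lemmas KD = proper_coneD[OF K]

lemma u_in: "u \<in> K" using u[of 0] r by simp

lemma zero_in: "0 \<in> K" using KD(3)[OF u_in, of 0] by simp

lemma au_pos: "a \<bullet> u > 0"
proof -
  have "u \<noteq> 0"
  proof
    assume "u = 0"
    obtain y :: 'a where y: "norm y = r" using r vector_choose_size[of r] by auto
    then have "y \<in> K" "- y \<in> K" using u[of y] u[of "-y"] \<open>u = 0\<close> by auto
    then have "y = 0" by (rule KD(5))
    then show False using y r by simp
  qed
  then have "c * norm u > 0" using c by simp
  with a[OF u_in] show ?thesis by linarith
qed

lemma a_nonneg: "x \<in> K \<Longrightarrow> 0 \<le> a \<bullet> x"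
  using a[of x] c by (meson mult_nonneg_nonneg less_imp_le norm_ge_zero order_trans)

text \<open>
  A linear map that preserves \<open>K\<close> is controlled by its value at the interior point \<open>u\<close>, since a
  multiple of \<open>u\<close> dominates both \<open>y\<close> and \<open>- y\<close>.
\<close>

lemma norm_positive_map_le:
  assumes f: "linear f" "f ` K \<subseteq> K"
  shows "norm (f y) \<le> 1 / (c * r) * (a \<bullet> f u) * norm y"
proof (cases "y = 0")
  case True
  then show ?thesis using linear_0[OF f(1)] by simp
next
  case False
  define t where "t = norm y / r"
  have t: "t > 0" using False r by (simp add: t_def)
  have "norm ((1 / t) *\<^sub>R y) \<le> r" using False r by (simp add: t_def)
  then have "t *\<^sub>R (u + (1 / t) *\<^sub>R y) \<in> K" "t *\<^sub>R (u + - ((1 / t) *\<^sub>R y)) \<in> K"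
    using t u[of "(1 / t) *\<^sub>R y"] u[of "- ((1 / t) *\<^sub>R y)"] by (intro KD(3); simp)+
  then have "t *\<^sub>R u + y \<in> K" "t *\<^sub>R u - y \<in> K" using t by (simp_all add: algebra_simps)
  then have p: "f (t *\<^sub>R u + y) \<in> K" "f (t *\<^sub>R u - y) \<in> K" using f(2) by auto
  have eqs: "f (t *\<^sub>R u + y) = t *\<^sub>R f u + f y" "f (t *\<^sub>R u - y) = t *\<^sub>R f u - f y"
    using f(1) by (simp_all add: linear_add linear_diff linear_scale)
  have "c * norm (f (t *\<^sub>R u + y)) + c * norm (f (t *\<^sub>R u - y)) \<le> 2 * t * (a \<bullet> f u)"
    using a[OF p(1)] a[OF p(2)] unfolding eqs by (simp add: inner_add_right inner_diff_right)
  moreover have "2 *\<^sub>R f y = f (t *\<^sub>R u + y) - f (t *\<^sub>R u - y)" unfolding eqs by (simp add: scaleR_2)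
  then have "2 * norm (f y) \<le> norm (f (t *\<^sub>R u + y)) + norm (f (t *\<^sub>R u - y))"
    by (metis norm_triangle_ineq4 norm_scaleR abs_numeral)
  then have "c * (2 * norm (f y)) \<le> c * norm (f (t *\<^sub>R u + y)) + c * norm (f (t *\<^sub>R u - y))"
    using c by (simp add: distrib_left[symmetric])
  ultimately have *: "2 * c * norm (f y) \<le> 2 * t * (a \<bullet> f u)" by linarith
  have "norm (f y) \<le> t * (a \<bullet> f u) / c" using * c by (simp add: field_simps)
  then show ?thesis using c r by (simp add: t_def field_simps)
qed

text \<open>
  Brouwer's theorem on the slice \<open>{x \<in> K. a \<bullet> x = 1}\<close>. Adding \<open>e u\<close> keeps the normalizing factor
  away from zero.
\<close>

lemma perturbed_eigenvector:
  assumes f: "linear f" "f ` K \<subseteq> K" and e: "e > 0"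
  obtains x where "x \<in> K" "a \<bullet> x = 1" "f x + e *\<^sub>R u = (a \<bullet> (f x + e *\<^sub>R u)) *\<^sub>R x"
proof -
  define \<Delta> where "\<Delta> = {x \<in> K. a \<bullet> x = 1}"
  have cl: "\<Delta> = K \<inter> {x. a \<bullet> x = 1}" by (auto simp: \<Delta>_def)
  have "bounded \<Delta>"
  proof (rule boundedI)
    fix x assume "x \<in> \<Delta>"
    then have "c * norm x \<le> 1" using a[of x] by (simp add: \<Delta>_def)
    then show "norm x \<le> 1 / c" using c by (simp add: field_simps)
  qed
  moreover have "closed \<Delta>" unfolding cl by (intro closed_Int KD(1) closed_hyperplane)
  ultimately have "compact \<Delta>" by (simp add: compact_eq_bounded_closed)
  have "convex \<Delta>" unfolding cl by (intro convex_Int KD(2) convex_hyperplane)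
  have "(1 / (a \<bullet> u)) *\<^sub>R u \<in> \<Delta>" using au_pos by (auto simp: \<Delta>_def intro!: KD(3) u_in)
  then have ne: "\<Delta> \<noteq> {}" by blast
  have pos: "a \<bullet> (f x + e *\<^sub>R u) > 0" if "x \<in> \<Delta>" for x
    using a_nonneg[of "f x"] that f(2) e au_pos by (auto simp: \<Delta>_def inner_add_right intro!: add_nonneg_pos)
  define \<phi> where "\<phi> = (\<lambda>x. (1 / (a \<bullet> (f x + e *\<^sub>R u))) *\<^sub>R (f x + e *\<^sub>R u))"
  have "continuous_on \<Delta> f" using f(1) by (simp add: linear_continuous_on linear_conv_bounded_linear)
  then have "continuous_on \<Delta> \<phi>" unfolding \<phi>_def using pos
    by (intro continuous_intros) (auto dest: pos)
  moreover have "\<phi> x \<in> \<Delta>" if "x \<in> \<Delta>" for x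
  proof -
    have "f x + e *\<^sub>R u \<in> K" using that f(2) e by (intro KD(4) KD(3) u_in) (auto simp: \<Delta>_def)
    then show ?thesis unfolding \<Delta>_def \<phi>_def using pos[OF that] by (auto intro!: KD(3))
  qed
  ultimately obtain x where x: "x \<in> \<Delta>" "\<phi> x = x"
    using brouwer[OF \<open>compact \<Delta>\<close> \<open>convex \<Delta>\<close> ne, of \<phi>] by blast
  have "f x + e *\<^sub>R u = (a \<bullet> (f x + e *\<^sub>R u)) *\<^sub>R \<phi> x"
    using pos[OF x(1)] by (simp add: \<phi>_def)
  then show ?thesis using that x by (auto simp: \<Delta>_def)
qed

end

lemma eigenpair_iterate_norm:
  fixes f :: "'a::euclidean_space \<Rightarrow> 'a"
  assumes f: "linear f" and 1: "f p = Re z *\<^sub>R p - Im z *\<^sub>R q" and 2: "f q = Im z *\<^sub>R p + Re z *\<^sub>R q"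
  shows "norm ((f ^^ n) p) ^ 2 + norm ((f ^^ n) q) ^ 2 = (norm z ^ n) ^ 2 * (norm p ^ 2 + norm q ^ 2)"
proof -
  have it: "(f ^^ n) p = Re (z ^ n) *\<^sub>R p - Im (z ^ n) *\<^sub>R q \<and> (f ^^ n) q = Im (z ^ n) *\<^sub>R p + Re (z ^ n) *\<^sub>R q"
  proof (induction n)
    case (Suc n)
    then have IH: "(f ^^ n) p = Re (z ^ n) *\<^sub>R p - Im (z ^ n) *\<^sub>R q" "(f ^^ n) q = Im (z ^ n) *\<^sub>R p + Re (z ^ n) *\<^sub>R q"
      by auto
    show ?case
      by (simp add: IH linear_add[OF f] linear_diff[OF f] linear_scale[OF f] 1 2 algebra_simps)
  qed simp
  have cm: "(Re (z ^ n))\<^sup>2 + (Im (z ^ n))\<^sup>2 = (norm z ^ n)\<^sup>2"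
    by (simp add: cmod_power2[symmetric] norm_power)
  have id: "norm (s *\<^sub>R p - t *\<^sub>R q) ^ 2 + norm (t *\<^sub>R p + s *\<^sub>R q) ^ 2 = (s\<^sup>2 + t\<^sup>2) * (norm p ^ 2 + norm q ^ 2)" for s t
    unfolding power2_norm_eq_inner
    by (simp add: inner_add_left inner_add_right inner_diff_left inner_diff_right inner_commute algebra_simps power2_eq_square)
  show ?thesis using it id[of "Re (z ^ n)" "Im (z ^ n)"] cm by simp
qed

context cone_frame
begin

text \<open>
  The perturbed eigenvector dominates a multiple of \<open>u\<close> and satisfies \<open>f x \<le> l x\<close>, so
  \<open>f ^^ n\<close> applied to \<open>u\<close> is dominated by a constant times \<open>l ^ n\<close>. Hence the norm of \<open>f ^^ n\<close> is at most a
  constant times \<open>l ^ n\<close>, which no eigenvalue of modulus greater than \<open>l\<close> allows.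
\<close>

lemma perturbed_eigenvalue_bound:
  assumes f: "linear f" "f ` K \<subseteq> K" and e: "e > 0"
    and x: "x \<in> K" "a \<bullet> x = 1" "f x + e *\<^sub>R u = l *\<^sub>R x" and l: "l > 0"
    and z: "real_eigenpair f z"
  shows "norm z \<le> l"
proof -
  have lin: "linear (f ^^ n)" for n
  proof (induction n)
    case (Suc n)
    then show ?case unfolding funpow.simps by (rule linear_compose[OF _ f(1)])
  qed (unfold funpow.simps, rule linear_id)
  have fK: "(f ^^ n) ` K \<subseteq> K" for n
    using f(2) by (induction n) (auto simp: image_subset_iff)
  have up: "l ^ n *\<^sub>R x - (f ^^ n) x \<in> K" for n
  proof (induction n)
    case (Suc n)
    have "f (l ^ n *\<^sub>R x - (f ^^ n) x) \<in> K" using Suc f(2) by auto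
    moreover have "l ^ n *\<^sub>R (e *\<^sub>R u) \<in> K" using l e by (intro KD(3) u_in) auto
    ultimately have "f (l ^ n *\<^sub>R x - (f ^^ n) x) + l ^ n *\<^sub>R (e *\<^sub>R u) \<in> K" by (rule KD(4))
    moreover have "l ^ n *\<^sub>R (e *\<^sub>R u) = l ^ Suc n *\<^sub>R x - l ^ n *\<^sub>R f x"
      using arg_cong[OF x(3), of "\<lambda>y. l ^ n *\<^sub>R y"] by (simp add: algebra_simps)
    ultimately show ?case
      using f(1) by (simp add: linear_diff linear_scale algebra_simps)
  qed (simp add: zero_in)
  have "(l / e) *\<^sub>R x - u = (1 / e) *\<^sub>R f x"
    using arg_cong[OF x(3), of "\<lambda>y. (1 / e) *\<^sub>R y"] e by (simp add: algebra_simps)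
  then have lx: "(l / e) *\<^sub>R x - u \<in> K"
    using x(1) f(2) e by (auto intro!: KD(3))
  have au: "a \<bullet> (f ^^ n) u \<le> l / e * l ^ n" for n
  proof -
    have "(f ^^ n) ((l / e) *\<^sub>R x - u) \<in> K" using lx fK by blast
    then have "a \<bullet> (f ^^ n) u \<le> l / e * (a \<bullet> (f ^^ n) x)"
      using a_nonneg[of "(f ^^ n) ((l / e) *\<^sub>R x - u)"]
      by (simp add: linear_diff[OF lin] linear_scale[OF lin] inner_diff_right)
    also have "\<dots> \<le> l / e * l ^ n"
      using a_nonneg[OF up[of n]] x(2) l e by (intro mult_left_mono) (simp_all add: inner_diff_right)
    finally show ?thesis .
  qed
  define D where "D = 1 / (c * r) * (l / e)"
  have D: "D > 0" using c r l e by (simp add: D_def)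
  have bnd: "norm ((f ^^ n) y) \<le> D * l ^ n * norm y" for n y
  proof -
    have "norm ((f ^^ n) y) \<le> 1 / (c * r) * (a \<bullet> (f ^^ n) u) * norm y"
      by (rule norm_positive_map_le[OF lin fK])
    also have "\<dots> \<le> 1 / (c * r) * (l / e * l ^ n) * norm y"
      using au c r by (intro mult_right_mono mult_left_mono) auto
    finally show ?thesis by (simp add: D_def)
  qed
  obtain p q where pq: "p \<noteq> 0 \<or> q \<noteq> 0" "f p = Re z *\<^sub>R p - Im z *\<^sub>R q" "f q = Im z *\<^sub>R p + Re z *\<^sub>R q"
    using z unfolding real_eigenpair_def by blast
  have N: "norm p ^ 2 + norm q ^ 2 > 0" using pq(1) by (simp add: sum_power2_gt_zero_iff)
  have pw: "norm z ^ n \<le> D * l ^ n" for n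
  proof -
    have "(norm z ^ n) ^ 2 * (norm p ^ 2 + norm q ^ 2) = norm ((f ^^ n) p) ^ 2 + norm ((f ^^ n) q) ^ 2"
      by (rule eigenpair_iterate_norm[OF f(1) pq(2,3), symmetric])
    also have "\<dots> \<le> (D * l ^ n * norm p) ^ 2 + (D * l ^ n * norm q) ^ 2"
      by (intro add_mono power_mono bnd) auto
    also have "\<dots> = (D * l ^ n) ^ 2 * (norm p ^ 2 + norm q ^ 2)"
      by (simp only: power_mult_distrib distrib_left)
    finally have "(norm z ^ n) ^ 2 \<le> (D * l ^ n) ^ 2" using N by (simp add: mult_le_cancel_right)
    then show ?thesis by (rule power2_le_imp_le) (use D l in auto)
  qed
  show ?thesis
  proof (rule ccontr)
    assume "\<not> ?thesis"
    then have "norm z / l > 1" using l by simp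
    then obtain n where "D < (norm z / l) ^ n" using real_arch_pow by blast
    with pw[of n] l show False by (simp add: power_divide field_simps)
  qed
qed

text \<open>
  The limit \<open>e \<rightarrow> 0\<close> of the perturbed eigenvectors, along a convergent subsequence.
\<close>

lemma perron_eigenvector:
  assumes f: "linear f" "f ` K \<subseteq> K" and z: "real_eigenpair f z"
  obtains x l where "x \<in> K" "x \<noteq> 0" "norm z \<le> l" "f x = l *\<^sub>R x"
proof -
  define e where "e = (\<lambda>n. inverse (real (Suc n)))"
  have e0: "e n > 0" for n by (simp add: e_def)
  have "\<exists>x. x \<in> K \<and> a \<bullet> x = 1 \<and> f x + e n *\<^sub>R u = (a \<bullet> (f x + e n *\<^sub>R u)) *\<^sub>R x" for n
    using perturbed_eigenvector[OF f e0] by blast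
  then obtain x where x: "\<And>n. x n \<in> K" "\<And>n. a \<bullet> x n = 1"
    "\<And>n. f (x n) + e n *\<^sub>R u = (a \<bullet> (f (x n) + e n *\<^sub>R u)) *\<^sub>R x n" by metis
  define l where "l = (\<lambda>n. a \<bullet> (f (x n) + e n *\<^sub>R u))"
  have x3: "f (x n) + e n *\<^sub>R u = l n *\<^sub>R x n" for n using x(3)[of n] by (simp add: l_def)
  have l0: "l n > 0" for n
    using a_nonneg[of "f (x n)"] x(1)[of n] f(2) e0[of n] au_pos
    by (auto simp: l_def inner_add_right intro!: add_nonneg_pos)
  have zl: "norm z \<le> l n" for n
    using perturbed_eigenvalue_bound[OF f e0 x(1,2) x3 l0 z] .
  have "bounded (range x)"
  proof (rule boundedI)
    fix y assume "y \<in> range x"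
    then have "c * norm y \<le> 1" using a x by fastforce
    then show "norm y \<le> 1 / c" using c by (simp add: field_simps)
  qed
  then obtain y s where s: "strict_mono s" "(x \<circ> s) \<longlonglongrightarrow> y"
    using bounded_imp_convergent_subsequence by blast
  have xs: "(\<lambda>n. x (s n)) \<longlonglongrightarrow> y" using s(2) by (simp add: comp_def)
  have es: "(\<lambda>n. e (s n)) \<longlonglongrightarrow> 0"
    using LIMSEQ_subseq_LIMSEQ[OF LIMSEQ_inverse_real_of_nat s(1)] by (simp add: e_def comp_def)
  have "bounded_linear f" using f(1) by (simp add: linear_conv_bounded_linear)
  then have fxs: "(\<lambda>n. f (x (s n))) \<longlonglongrightarrow> f y" using xs by (rule bounded_linear.tendsto)
  have lim: "(\<lambda>n. f (x (s n)) + e (s n) *\<^sub>R u) \<longlonglongrightarrow> f y + 0 *\<^sub>R u"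
    by (intro tendsto_intros fxs es)
  then have ll: "(\<lambda>n. l (s n)) \<longlonglongrightarrow> a \<bullet> f y" 
    unfolding l_def using tendsto_inner[OF tendsto_const[of a] lim] by simp
  have "(\<lambda>n. f (x (s n)) + e (s n) *\<^sub>R u) \<longlonglongrightarrow> (a \<bullet> f y) *\<^sub>R y"
    using tendsto_scaleR[OF ll xs] unfolding x3 .
  from LIMSEQ_unique[OF lim this] have eig: "f y = (a \<bullet> f y) *\<^sub>R y" by simp
  have "y \<in> K" using closed_sequentially[OF KD(1) _ xs] x(1) by blast
  moreover have "a \<bullet> y = 1"
    using tendsto_inner[OF tendsto_const xs, of a] x(2) by (simp add: LIMSEQ_const_iff)
  then have "y \<noteq> 0" by auto
  moreover have "norm z \<le> a \<bullet> f y" using LIMSEQ_le_const[OF ll] zl by blast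
  ultimately show ?thesis using that[of y "a \<bullet> f y"] eig by simp
qed

end

section \<open>Cone translates of positive measure\<close>

lemma closed_measure_support: "closed (measure_support \<mu>)"
proof -
  have "- measure_support \<mu> = \<Union>{U. open U \<and> emeasure \<mu> U = 0}"
    by (auto simp: measure_support_def)
  then have "open (- measure_support \<mu>)" by auto
  then show ?thesis by (simp add: closed_def)
qed

lemma emeasure_compl_support:
  fixes \<mu> :: "'a::second_countable_topology measure"
  assumes sets: "sets \<mu> = sets borel"
  shows "emeasure \<mu> (- measure_support \<mu>) = 0"
proof -
  let ?F = "{U. open U \<and> emeasure \<mu> U = 0}"
  have eq: "- measure_support \<mu> = \<Union>?F" by (auto simp: measure_support_def)
  obtain F' where F': "F' \<subseteq> ?F" "countable F'" "\<Union>F' = \<Union>?F"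
    using Lindelof[of ?F] by auto
  have "\<Union>F' \<in> null_sets \<mu>"
    using F' sets by (intro null_sets_UN'[where N = "\<lambda>x. x", simplified]) (auto simp: null_sets_def)
  then show ?thesis unfolding eq F'(3)[symmetric] by auto
qed

lemma emeasure_Int_support:
  fixes \<mu> :: "'a::second_countable_topology measure"
  assumes sets: "sets \<mu> = sets borel" and B: "B \<in> sets borel"
  shows "emeasure \<mu> (B \<inter> measure_support \<mu>) = emeasure \<mu> B"
proof -
  have m: "measure_support \<mu> \<in> sets borel" "- measure_support \<mu> \<in> sets borel"
    using closed_measure_support[of \<mu>] by (auto simp: borel_comp)
  then have "- measure_support \<mu> \<in> null_sets \<mu>"
    using emeasure_compl_support[OF sets] sets by (auto simp: null_sets_def)
  then have "emeasure \<mu> (B - (- measure_support \<mu>)) = emeasure \<mu> B"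
    using B sets by (intro emeasure_Diff_null_set) auto
  then show ?thesis by (simp add: Diff_eq)
qed

text \<open>
  The translates of \<open>Z\<close> by \<open>e, e/2, e/3, \<dots>\<close> are disjoint, of equal measure and uniformly bounded.
\<close>

lemma lborel_null_if_meets_lines_once:
  fixes Z :: "'a::euclidean_space set"
  assumes Z: "Z \<in> sets borel" and bdd: "bounded Z"
    and once: "\<And>x t. x \<in> Z \<Longrightarrow> 0 < t \<Longrightarrow> x + t *\<^sub>R e \<notin> Z"
  shows "emeasure lborel Z = 0"
proof -
  obtain R where R: "\<And>x. x \<in> Z \<Longrightarrow> norm x \<le> R" using bdd by (auto simp: bounded_iff)
  have lm: "Z \<in> lmeasurable"
    using bounded_set_imp_lmeasurable[OF bdd] Z by (simp add: sets_completionI_sets)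
  define s where "s = (\<lambda>i. inverse (real (Suc i)))"
  define V where "V = (\<lambda>i. (+) (s i *\<^sub>R e) ` Z)"
  have s: "0 < s i" "s i \<le> 1" for i by (auto simp: s_def field_simps)
  have disj: "V i \<inter> V j = {}" if "i < j" for i j
  proof (rule ccontr)
    assume "V i \<inter> V j \<noteq> {}"
    then obtain x y where xy: "x \<in> Z" "y \<in> Z" "s i *\<^sub>R e + x = s j *\<^sub>R e + y" by (auto simp: V_def)
    then have "y = x + (s i - s j) *\<^sub>R e" by (simp add: algebra_simps)
    moreover have "0 < s i - s j" using that by (simp add: s_def less_imp_inverse_less)
    ultimately show False using once[OF xy(1)] xy(2) by blast
  qed
  have dfam: "disjoint_family_on V {..<N}" for N
    unfolding disjoint_family_on_def using disj by (metis linorder_neqE_nat Int_commute)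
  have Vm: "V i \<in> lmeasurable" for i unfolding V_def using lm by (rule measurable_translation)
  have mV: "measure lebesgue (V i) = measure lebesgue Z" for i
    unfolding V_def by (rule measure_translation)
  let ?B = "cball (0::'a) (R + norm e)"
  have VB: "V i \<subseteq> ?B" for i
  proof
    fix y assume "y \<in> V i"
    then obtain x where x: "x \<in> Z" "y = s i *\<^sub>R e + x" by (auto simp: V_def)
    have "norm y \<le> norm (s i *\<^sub>R e) + norm x" unfolding x(2) by (rule norm_triangle_ineq)
    also have "norm (s i *\<^sub>R e) \<le> 1 * norm e"
      using s[of i] by (simp add: mult_left_le_one_le)
    finally show "y \<in> ?B" using R[OF x(1)] by simp
  qed
  have bound: "real N * measure lebesgue Z \<le> measure lebesgue ?B" for N
  proof -
    have "real N * measure lebesgue Z = (\<Sum>i<N. measure lebesgue (V i))" by (simp add: mV)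
    also have "\<dots> = measure lebesgue (\<Union>i\<in>{..<N}. V i)"
      using dfam fmeasurableD[OF Vm] fmeasurableD2[OF Vm]
      by (intro measure_finite_Union[symmetric]) (auto simp del: emeasure_completion)
    also have "\<dots> \<le> measure lebesgue ?B"
      using VB Vm by (intro measure_mono_fmeasurable sets.finite_UN) (auto intro: fmeasurableD)
    finally show ?thesis .
  qed
  have "measure lebesgue Z = 0"
  proof (rule ccontr)
    assume "measure lebesgue Z \<noteq> 0"
    then have "measure lebesgue Z > 0" by (simp add: zero_less_measure_iff)
    then obtain N where "measure lebesgue ?B < real N * measure lebesgue Z"
      using reals_Archimedean3 by blast
    with bound[of N] show False by simp
  qed
  then have "emeasure lebesgue Z = 0" using lm by (simp add: emeasure_eq_measure2)
  then show ?thesis using Z by simp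
qed

text \<open>
  If no point of \<open>S\<close> were charged, then by the Lindeloef property \<open>\<mu>\<close> would not see the union \<open>U\<close> of the
  translates of \<open>interior P\<close> by points of \<open>S\<close>. What remains of \<open>S\<close> meets each line in direction \<open>e\<close>
  at most once. It is Lebesgue null, so its mass comes from an atom \<open>M i\<close>, which lies
  in its own translate of \<open>P\<close>.
\<close>

lemma exists_charged_translate:
  fixes \<mu> :: "'a::euclidean_space measure" and P :: "'a set" and m :: nat
  assumes sets: "sets \<mu> = sets borel" and sing: "singular_part \<mu> \<mu>s"
    and w: "\<And>i. i < m \<Longrightarrow> 0 < w i"
    and atoms: "\<And>B. B \<in> sets borel \<Longrightarrow>
           emeasure \<mu>s B = (\<Sum>i<m. ennreal (w i) * emeasure (return borel (M i)) B)"
    and P: "P \<in> sets borel" "0 \<in> P" and e: "\<And>t. 0 < t \<Longrightarrow> t *\<^sub>R e \<in> interior P"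
    and S: "S \<in> sets borel" "bounded S" "emeasure \<mu> S > 0"
  shows "\<exists>x\<in>S. emeasure \<mu> {y. y - x \<in> P} > 0"
proof (rule ccontr)
  assume "\<not> ?thesis"
  then have zero: "emeasure \<mu> {y. y - x \<in> P} = 0" if "x \<in> S" for x using that by auto
  obtain \<mu>a where ac: "absolutely_continuous lborel \<mu>a"
    and dec: "\<And>B. B \<in> sets borel \<Longrightarrow> emeasure \<mu> B = emeasure \<mu>a B + emeasure \<mu>s B"
    using sing unfolding singular_part_def by blast
  have Pm: "{y. y - x \<in> P} \<in> sets \<mu>" for x
  proof -
    have "(\<lambda>y. y - x) -` P \<inter> space borel \<in> sets borel"
      by (rule measurable_sets[OF _ P(1)]) simp
    then show ?thesis using sets by (simp add: vimage_def)
  qed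
  let ?F = "(\<lambda>x. (+) x ` interior P) ` S"
  have "\<And>U. U \<in> ?F \<Longrightarrow> open U" by (auto intro: open_translation)
  then obtain F' where F': "F' \<subseteq> ?F" "countable F'" "\<Union>F' = \<Union>?F" using Lindelof[of ?F] by metis
  have "\<Union>F' \<in> null_sets \<mu>"
  proof (rule null_sets_UN'[where N = "\<lambda>x. x", simplified])
    fix U assume "U \<in> F'"
    then obtain x where x: "x \<in> S" "U = (+) x ` interior P" using F'(1) by auto
    have "U \<subseteq> {y. y - x \<in> P}" unfolding x(2) using interior_subset[of P] by auto
    then have "emeasure \<mu> U = 0" using emeasure_mono[OF _ Pm, of U x] zero[OF x(1)] by simp
    moreover have "open U" unfolding x(2) by (intro open_translation) auto
    ultimately show "U \<in> null_sets \<mu>" using sets by (auto simp: null_sets_def)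
  qed (fact F')
  then have null: "\<Union>?F \<in> null_sets \<mu>" by (simp only: F'(3))
  define Z where "Z = S - \<Union>?F"
  have Zpos: "emeasure \<mu> Z > 0"
    unfolding Z_def using S sets null by (subst emeasure_Diff_null_set) auto
  have Zb: "Z \<in> sets borel" using S(1) null sets by (auto simp: Z_def)
  have "emeasure lborel Z = 0"
  proof (rule lborel_null_if_meets_lines_once[OF Zb])
    show "bounded Z" using S(2) bounded_subset by (auto simp: Z_def)
    show "x + t *\<^sub>R e \<notin> Z" if "x \<in> Z" "0 < t" for x t
      using that e[OF that(2)] by (auto simp: Z_def)
  qed
  then have "Z \<in> null_sets \<mu>a" using ac Zb by (auto simp: absolutely_continuous_def null_sets_def)
  then have "emeasure \<mu> Z = emeasure \<mu>s Z" using dec[OF Zb] by auto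
  then have "emeasure \<mu>s Z \<noteq> 0" using Zpos by simp
  then have ne0: "(\<Sum>i<m. ennreal (w i) * emeasure (return borel (M i)) Z) \<noteq> 0"
    unfolding atoms[OF Zb] .
  have "\<exists>i<m. emeasure (return borel (M i)) Z \<noteq> 0"
  proof (rule ccontr)
    assume "\<not> ?thesis"
    then have "(\<Sum>i<m. ennreal (w i) * emeasure (return borel (M i)) Z) = 0"
      by (intro sum.neutral) simp
    from ne0 this show False by (rule notE)
  qed
  then obtain i where i: "i < m" "emeasure (return borel (M i)) Z \<noteq> 0" by auto
  then have Mi: "M i \<in> Z" using Zb by (auto simp: emeasure_return indicator_def split: if_splits)
  have "ennreal (w i) = ennreal (w i) * emeasure (return borel (M i)) {M i}" by simp
  also have "\<dots> \<le> (\<Sum>j<m. ennreal (w j) * emeasure (return borel (M j)) {M i})"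
    using i by (intro member_le_sum[where f = "\<lambda>j. ennreal (w j) * emeasure (return borel (M j)) {M i}"]) auto
  also have "\<dots> = emeasure \<mu>s {M i}" by (rule atoms[symmetric]) simp
  also have "\<dots> \<le> emeasure \<mu> {M i}" by (simp add: dec)
  also have "\<dots> \<le> emeasure \<mu> {y. y - M i \<in> P}" using P(2) by (intro emeasure_mono Pm) auto
  also have "\<dots> = 0" using Mi by (intro zero) (auto simp: Z_def)
  finally show False using w[OF i(1)] by simp
qed

definition cone_maps :: "(real^'n) set \<Rightarrow> (real^'n^'n) set" where
  "cone_maps K = {X. \<forall>x\<in>K. X *v x \<in> K}"

lemma closed_cone_maps:
  fixes K :: "(real^'n) set"
  assumes "closed K"
  shows "closed (cone_maps K)"
proof -
  have cont: "continuous_on UNIV (\<lambda>X :: real^'n^'n. X *v x)" for x :: "real^'n"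
  proof -
    have "linear (\<lambda>X :: real^'n^'n. X *v x)"
      by (intro linearI) (simp_all add: matrix_vector_mult_add_rdistrib scaleR_matrix_vector_assoc)
    then show ?thesis by (simp add: linear_continuous_on linear_conv_bounded_linear)
  qed
  have "closed {X :: real^'n^'n. X *v x \<in> K}" for x
    using closed_vimage[OF assms cont[of x]] by (simp add: vimage_def)
  then have "closed (\<Inter>x\<in>K. {X :: real^'n^'n. X *v x \<in> K})" by (intro closed_INT ballI)
  also have "(\<Inter>x\<in>K. {X :: real^'n^'n. X *v x \<in> K}) = cone_maps K" by (auto simp: cone_maps_def)
  finally show ?thesis .
qed

lemma cone_maps_mat_prod:
  assumes "\<And>i. i \<in> {1..k} \<Longrightarrow> B i \<in> cone_maps K"
  shows "mat_prod B k \<in> cone_maps K"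
  using assms
proof (induction k)
  case (Suc k)
  have "B (Suc k) \<in> cone_maps K" by (rule Suc.prems) simp
  moreover have "mat_prod B k \<in> cone_maps K" by (intro Suc.IH Suc.prems) simp
  ultimately show ?case by (simp add: cone_maps_def matrix_vector_mul_assoc[symmetric])
qed (simp add: cone_maps_def)

text \<open>
  The rank-one matrix \<open>x \<mapsto> (a \<bullet> x) u\<close> sends the nonzero points of \<open>K\<close> uniformly far into the interior
  of \<open>K\<close>.
\<close>

lemma cone_maps_interior_direction:
  fixes K :: "(real^'n) set"
  assumes "cone_frame K a u c r" and t: "0 < t"
  shows "t *\<^sub>R (\<chi> i j. u $ i * a $ j) \<in> interior (cone_maps K)"
proof -
  interpret cone_frame K a u c r by fact
  let ?E = "\<chi> i j. u $ i * a $ j"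
  have E: "?E *v x = (a \<bullet> x) *\<^sub>R u" for x
    by (simp add: vec_eq_iff matrix_vector_mult_def inner_vec_def sum_distrib_left algebra_simps)
  define d where "d = t * c * r / real CARD('n) ^ 2"
  have d: "d > 0" using t c r by (simp add: d_def)
  have "ball (t *\<^sub>R ?E) d \<subseteq> cone_maps K"
  proof
    fix Y assume "Y \<in> ball (t *\<^sub>R ?E) d"
    then have Y: "norm (Y - t *\<^sub>R ?E) \<le> d" by (simp add: dist_norm norm_minus_commute)
    have "Y *v x \<in> K" if x: "x \<in> K" for x
    proof (cases "x = 0")
      case True
      then show ?thesis by (simp add: zero_in)
    next
      case False
      define b where "b = t * (a \<bullet> x)"
      have "c * norm x > 0" using c False by simp
      then have b: "b > 0" using a[OF x] t by (simp add: b_def)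
      define y where "y = (1 / b) *\<^sub>R ((Y - t *\<^sub>R ?E) *v x)"
      have "norm ((Y - t *\<^sub>R ?E) *v x) \<le> real CARD('n) ^ 2 * norm (Y - t *\<^sub>R ?E) * norm x"
        by (rule norm_matrix_vector_le)
      also have "\<dots> \<le> real CARD('n) ^ 2 * d * norm x"
        using Y by (intro mult_right_mono mult_left_mono) auto
      also have "\<dots> = t * r * (c * norm x)" by (simp add: d_def)
      also have "\<dots> \<le> t * r * (a \<bullet> x)" using a[OF x] t r by (intro mult_left_mono) auto
      finally have "norm y \<le> r" using b by (simp add: y_def b_def field_simps)
      then have "b *\<^sub>R (u + y) \<in> K" using u b by (intro KD(3)) auto
      moreover have "b *\<^sub>R (u + y) = Y *v x"
      proof -
        have "b *\<^sub>R y = (Y - t *\<^sub>R ?E) *v x" using b by (simp add: y_def)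
        also have "\<dots> = Y *v x - b *\<^sub>R u"
          by (simp add: matrix_vector_mult_diff_rdistrib scaleR_matrix_vector_assoc[symmetric] E b_def)
        finally show ?thesis by (simp add: scaleR_add_right)
      qed
      ultimately show ?thesis by simp
    qed
    then show "Y \<in> cone_maps K" by (simp add: cone_maps_def)
  qed
  then show ?thesis unfolding mem_interior using d by (intro exI[of _ d] conjI)
qed

lemma charged_translates_dense:
  fixes K :: "(real^'n) set" and \<mu> :: "(real^'n^'n) measure" and m :: nat
  assumes frame: "cone_frame K a u c r"
    and sets: "sets \<mu> = sets borel" and sing: "singular_part \<mu> \<mu>s"
    and w: "\<And>i. i < m \<Longrightarrow> 0 < w i"
    and atoms: "\<And>B. B \<in> sets borel \<Longrightarrow>
           emeasure \<mu>s B = (\<Sum>i<m. ennreal (w i) * emeasure (return borel (M i)) B)"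
    and A: "A \<in> measure_support \<mu>" and e: "0 < e"
  shows "\<exists>X\<in>measure_support \<mu>. dist X A < e \<and> emeasure \<mu> {Y. Y - X \<in> cone_maps K} > 0"
proof -
  interpret cone_frame K a u c r by fact
  let ?S = "ball A e \<inter> measure_support \<mu>"
  have "\<forall>U. open U \<longrightarrow> A \<in> U \<longrightarrow> 0 < emeasure \<mu> U"
    using A unfolding measure_support_def by (rule CollectD)
  from this[rule_format, of "ball A e"] have "emeasure \<mu> (ball A e) > 0" using e by simp
  then have S: "emeasure \<mu> ?S > 0" by (subst emeasure_Int_support[OF sets]) auto
  have Sb: "?S \<in> sets borel" using closed_measure_support[of \<mu>] by auto
  have bS: "bounded ?S" by (rule bounded_subset[OF bounded_ball[of A e]]) auto
  have Pb: "cone_maps K \<in> sets borel" using closed_cone_maps[OF KD(1)] by simp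
  have P0: "0 \<in> cone_maps K" by (simp add: cone_maps_def zero_in)
  obtain X where "X \<in> ?S" "emeasure \<mu> {Y. Y - X \<in> cone_maps K} > 0"
    using exists_charged_translate[OF sets sing w atoms Pb P0 cone_maps_interior_direction[OF frame] Sb bS S]
    by auto
  then show ?thesis by (intro bexI[of _ X] conjI) (simp_all add: dist_commute)
qed

section \<open>Moments of random products\<close>

lemma submultiplicative_geometric_bound:
  fixes a :: "nat \<Rightarrow> real"
  assumes sub: "\<And>m n. 1 \<le> m \<Longrightarrow> 1 \<le> n \<Longrightarrow> a (m + n) \<le> a m * a n"
    and nonneg: "\<And>n. 0 \<le> a n"
    and t: "0 < t" and m: "1 \<le> m" "a m \<le> t ^ m"
  obtains C where "0 < C" "\<And>n. 1 \<le> n \<Longrightarrow> a n \<le> C * t ^ n"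
proof -
  define C where "C = 1 + (\<Sum>r\<le>m. a r / t ^ r)"
  have C: "C > 0" unfolding C_def using nonneg t by (intro add_pos_nonneg sum_nonneg) auto
  have "a n \<le> C * t ^ n" if "1 \<le> n" for n
    using that
  proof (induction n rule: less_induct)
    case (less n)
    show ?case
    proof (cases "n \<le> m")
      case True
      have "a n / t ^ n \<le> (\<Sum>r\<le>m. a r / t ^ r)"
        using True nonneg t by (intro member_le_sum) auto
      then have "a n / t ^ n \<le> C" by (simp add: C_def)
      then show ?thesis using t by (simp add: field_simps)
    next
      case False
      have "a n \<le> a m * a (n - m)" using sub[of m "n - m"] False m by simp
      also have "\<dots> \<le> t ^ m * (C * t ^ (n - m))"
        using less.IH[of "n - m"] False m nonneg t C by (intro mult_mono) auto
      also have "\<dots> = C * t ^ n" using False by (simp add: power_add[symmetric] mult.left_commute)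
      finally show ?thesis .
    qed
  qed
  then show ?thesis using that C by blast
qed

lemma const_powr_inverse_tendsto_1:
  fixes C :: real
  assumes "0 < C"
  shows "(\<lambda>n. C powr (1 / real n)) \<longlonglongrightarrow> 1"
proof -
  have "(\<lambda>n. C powr (1 / real n)) \<longlonglongrightarrow> C powr 0"
    using assms by (intro tendsto_powr tendsto_const lim_1_over_n) auto
  then show ?thesis using assms by simp
qed

lemma root_of_geometric:
  assumes "0 < C" "0 < t" "1 \<le> n" 
  shows "(C * t ^ n) powr (1 / real n) = C powr (1 / real n) * t"
  using assms by (simp add: powr_mult powr_powr powr_realpow[symmetric])

text \<open>
  Fekete's lemma in multiplicative form; it also covers sequences that vanish or decay faster than
  any geometric sequence.
\<close>

lemma submultiplicative_root_convergent:
  fixes a :: "nat \<Rightarrow> real"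
  assumes sub: "\<And>m n. 1 \<le> m \<Longrightarrow> 1 \<le> n \<Longrightarrow> a (m + n) \<le> a m * a n"
    and nonneg: "\<And>n. 0 \<le> a n"
  shows "convergent (\<lambda>n. a n powr (1 / real n))"
proof -
  let ?r = "\<lambda>n. a n powr (1 / real n)"
  define l where "l = Inf (?r ` {1..})"
  have bdd: "bdd_below (?r ` {1..})" by (intro bdd_belowI2[of _ 0]) auto
  have low: "l \<le> ?r n" if "1 \<le> n" for n
    unfolding l_def using that by (intro cInf_lower bdd) auto
  have l0: "0 \<le> l" unfolding l_def by (intro cInf_greatest) auto
  have "?r \<longlonglongrightarrow> l"
  proof (rule order_tendstoI)
    fix y assume "y < l"
    then show "eventually (\<lambda>n. y < ?r n) sequentially"
      using low by (intro eventually_sequentiallyI[of 1]) (auto intro: less_le_trans)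
  next
    fix y assume y: "l < y"
    define t where "t = (l + y) / 2"
    have t: "l < t" "t < y" "0 < t" using y l0 by (auto simp: t_def)
    obtain m where m: "1 \<le> m" "?r m < t"
      using cInf_lessD[of "?r ` {1..}" t] t(1) unfolding l_def[symmetric] by auto
    have "a m = ?r m ^ m"
    proof (cases "a m = 0")
      case False
      then have "0 < a m" using nonneg[of m] by simp
      then show ?thesis using m(1) by (simp add: powr_realpow[symmetric] powr_powr)
    qed (use m(1) in auto)
    also have "\<dots> \<le> t ^ m" using m(2) by (intro power_mono) auto
    finally obtain C where C: "0 < C" "\<And>n. 1 \<le> n \<Longrightarrow> a n \<le> C * t ^ n"
      using submultiplicative_geometric_bound[of a, OF sub nonneg t(3) m(1)] by blast
    have "(\<lambda>n. C powr (1 / real n) * t) \<longlonglongrightarrow> 1 * t"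
      by (intro tendsto_intros const_powr_inverse_tendsto_1 C(1))
    then have "eventually (\<lambda>n. C powr (1 / real n) * t < y) sequentially"
      using t(2) by (intro order_tendstoD(2)[of _ "1 * t"]) auto
    then show "eventually (\<lambda>n. ?r n < y) sequentially"
      using eventually_ge_at_top[of 1]
    proof eventually_elim
      case (elim n)
      have "?r n \<le> (C * t ^ n) powr (1 / real n)"
        using C(2)[OF elim(2)] nonneg by (intro powr_mono2) auto
      then show ?case using root_of_geometric[OF C(1) t(3) elim(2)] elim(1) by simp
    qed
  qed
  then show ?thesis by (rule convergentI)
qed

lemma is_norm_matrix_mult_le:
  fixes N :: "real^'n^'n \<Rightarrow> real"
  assumes "is_norm N"
  obtains C where "0 < C" "\<And>A B. N (A ** B) \<le> C * N A * N B"
proof -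
  obtain C1 where C1: "0 < C1" "\<And>A. N A \<le> C1 * norm A" using is_norm_le_norm[OF assms] by blast
  obtain C2 where C2: "0 < C2" "\<And>A. norm A \<le> C2 * N A" using norm_le_is_norm[OF assms] by blast
  let ?d = "real CARD('n) ^ 2"
  have d: "?d > 0" by simp
  have "N (A ** B) \<le> (C1 * ?d * ?d * ?d * C2 * C2) * N A * N B" for A B
  proof -
    have "norm ((A ** B) *v x) \<le> (?d * norm A * (?d * norm B)) * norm x" for x
    proof -
      have "norm ((A ** B) *v x) \<le> ?d * norm A * norm (B *v x)"
        using norm_matrix_vector_le[of A "B *v x"] by (simp add: matrix_vector_mul_assoc)
      also have "\<dots> \<le> ?d * norm A * (?d * norm B * norm x)"
        by (intro mult_left_mono norm_matrix_vector_le) auto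
      finally show ?thesis by (simp add: mult.assoc)
    qed
    then have "norm (A ** B) \<le> ?d * (?d * norm A * (?d * norm B))" by (rule norm_matrix_le)
    also have "\<dots> \<le> ?d * (?d * (C2 * N A) * (?d * (C2 * N B)))"
      using C2 is_normD(1)[OF assms] by (intro mult_left_mono mult_mono) auto
    finally have "C1 * norm (A ** B) \<le> C1 * (?d * (?d * (C2 * N A) * (?d * (C2 * N B))))"
      using C1(1) by (intro mult_left_mono) auto
    with C1(2)[of "A ** B"] show ?thesis by (simp add: algebra_simps)
  qed
  then show ?thesis using that[of "C1 * ?d * ?d * ?d * C2 * C2"] C1(1) C2(1) d by (simp add: mult_pos_pos)
qed

text \<open>
  The setting of the moments: every factor of the random product lies in the compact support almost
  surely, so all moments are finite.
\<close>

locale iid_matrices =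
  fixes \<mu> :: "(real^'n^'n) measure" and N :: "real^'n^'n \<Rightarrow> real"
  assumes N: "is_norm N" and prob: "prob_space \<mu>" and sets: "sets \<mu> = sets borel"
    and compact: "compact (measure_support \<mu>)"
    and AE_support: "AE A in \<mu>. A \<in> measure_support \<mu>"
begin

interpretation prob_space \<mu> by (rule prob)
interpretation P: product_prob_space "\<lambda>_::nat. \<mu>" by unfold_locales

abbreviation "iid I \<equiv> Pi\<^sub>M I (\<lambda>_::nat. \<mu>)"

lemma measurable_N: "N \<in> borel_measurable borel"
  by (intro borel_measurable_continuous_onI is_norm_continuous[OF N])

lemma measurable_product: "(\<lambda>A. mat_prod A k) \<in> borel_measurable (iid {1..k})"
proof (rule measurable_mat_prod)
  fix i assume "i \<in> {1..k}"
  then have "(\<lambda>A. A i) \<in> iid {1..k} \<rightarrow>\<^sub>M \<mu>" by (rule measurable_component_singleton)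
  then show "(\<lambda>A. A i) \<in> borel_measurable (iid {1..k})"
    using measurable_cong_sets[OF refl sets] by blast
qed

lemma measurable_norm_power: "(\<lambda>A. N (mat_prod A k) ^ p) \<in> borel_measurable (iid {1..k})"
  using measurable_compose[OF measurable_product measurable_N] by simp

lemma AE_in_support: "AE A in iid {1..k}. \<forall>i\<in>{1..k}. A i \<in> measure_support \<mu>"
  by (intro AE_finite_allI finite_atLeastAtMost AE_PiM_component prob AE_support)

lemma support_product_bounded:
  "\<exists>b\<ge>0. \<forall>A. (\<forall>i\<in>{1..k}. A i \<in> measure_support \<mu>) \<longrightarrow> N (mat_prod A k) \<le> b"
proof (induction k)
  case 0
  then show ?case using is_normD(1)[OF N] by (intro exI[of _ "N (mat 1)"]) simp
next
  case (Suc k)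
  obtain C where C: "0 < C" "\<And>A B. N (A ** B) \<le> C * N A * N B" using is_norm_matrix_mult_le[OF N] by blast
  obtain b where bb: "0 \<le> b \<and> (\<forall>A. (\<forall>i\<in>{1..k}. A i \<in> measure_support \<mu>) \<longrightarrow> N (mat_prod A k) \<le> b)"
    using Suc ..
  note b = conjunct1[OF bb] mp[OF spec[OF conjunct2[OF bb]]]
  obtain C1 where C1: "0 < C1" "\<And>A. N A \<le> C1 * norm A" using is_norm_le_norm[OF N] by blast
  obtain R where R: "0 < R" "\<And>A. A \<in> measure_support \<mu> \<Longrightarrow> norm A \<le> R"
    using compact_imp_bounded[OF compact] by (auto simp: bounded_pos)
  have "N (mat_prod A (Suc k)) \<le> C * (C1 * R) * b" if A: "\<forall>i\<in>{1..Suc k}. A i \<in> measure_support \<mu>" for A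
  proof -
    have "N (A (Suc k)) \<le> C1 * R"
    proof -
      have "norm (A (Suc k)) \<le> R" using A by (intro R(2)) auto
      from mult_left_mono[OF this, of C1] C1 show ?thesis by (meson less_imp_le order_trans)
    qed
    moreover have "N (mat_prod A k) \<le> b" using A by (intro b(2)) auto
    ultimately have "C * N (A (Suc k)) * N (mat_prod A k) \<le> C * (C1 * R) * b"
      using C(1) C1(1) R(1) b(1) is_normD(1)[OF N] by (intro mult_mono) auto
    then show ?thesis using C(2)[of "A (Suc k)" "mat_prod A k"] by simp
  qed
  then show ?case using C(1) C1(1) R(1) b(1) by (intro exI[of _ "C * (C1 * R) * b"]) auto
qed

lemma integrable_norm_power: "integrable (iid {1..k}) (\<lambda>A. N (mat_prod A k) ^ p)"
proof -
  obtain b where bb: "0 \<le> b \<and> (\<forall>A. (\<forall>i\<in>{1..k}. A i \<in> measure_support \<mu>) \<longrightarrow> N (mat_prod A k) \<le> b)"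
    using support_product_bounded[of k] ..
  note b = conjunct1[OF bb] mp[OF spec[OF conjunct2[OF bb]]]
  interpret PK: prob_space "iid {1..k}" by (rule prob_space_PiM) (rule prob)
  show ?thesis
  proof (rule PK.integrable_const_bound[where B = "b ^ p"])
    show "AE A in iid {1..k}. norm (N (mat_prod A k) ^ p) \<le> b ^ p"
      using AE_in_support[of k]
      by eventually_elim (use b is_normD(1)[OF N] in \<open>auto intro!: power_mono\<close>)
  qed (rule measurable_norm_power)
qed

lemma Lp_moment_le:
  assumes "0 \<le> b" "\<And>A. (\<forall>i\<in>{1..k}. A i \<in> measure_support \<mu>) \<Longrightarrow> N (mat_prod A k) \<le> b"
  shows "Lp_moment N p \<mu> k \<le> b ^ p"
proof -
  interpret PK: prob_space "iid {1..k}" by (rule prob_space_PiM) (rule prob)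
  show ?thesis unfolding Lp_moment_def
  proof (rule PK.integral_le_const[OF integrable_norm_power])
    show "AE A in iid {1..k}. N (mat_prod A k) ^ p \<le> b ^ p"
      using AE_in_support[of k]
      by eventually_elim (use assms is_normD(1)[OF N] in \<open>auto intro!: power_mono\<close>)
  qed
qed

lemma Lp_moment_nonneg: "0 \<le> Lp_moment N p \<mu> k"
  unfolding Lp_moment_def using is_normD(1)[OF N] by simp

lemma Lp_moment_nn_integral:
  "ennreal (Lp_moment N p \<mu> k) = (\<integral>\<^sup>+A. ennreal (N (mat_prod A k) ^ p) \<partial>iid {1..k})"
  unfolding Lp_moment_def
  by (rule nn_integral_eq_integral[symmetric, OF integrable_norm_power])
     (use is_normD(1)[OF N] in auto)

lemma Lp_moment_shift:
  "(\<integral>\<^sup>+y. ennreal (N (mat_prod (\<lambda>i. y (i + m)) n) ^ p) \<partial>iid {Suc m..m+n}) = ennreal (Lp_moment N p \<mu> n)"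
proof -
  let ?s = "\<lambda>y. \<lambda>i\<in>{1..n}. y (i + m)"
  have "distr (iid {Suc m..m+n}) (iid {1..n}) ?s = iid {1..n}"
    by (rule distr_PiM_reindex) (auto simp: prob)
  then have "ennreal (Lp_moment N p \<mu> n) = (\<integral>\<^sup>+A. ennreal (N (mat_prod A n) ^ p) \<partial>distr (iid {Suc m..m+n}) (iid {1..n}) ?s)"
    by (simp add: Lp_moment_nn_integral)
  also have "\<dots> = (\<integral>\<^sup>+y. ennreal (N (mat_prod (?s y) n) ^ p) \<partial>iid {Suc m..m+n})"
  proof (rule nn_integral_distr)
    show "?s \<in> iid {Suc m..m+n} \<rightarrow>\<^sub>M iid {1..n}"
      by (intro measurable_restrict measurable_component_singleton) auto
  qed (use measurable_norm_power in simp)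
  also have "\<dots> = (\<integral>\<^sup>+y. ennreal (N (mat_prod (\<lambda>i. y (i + m)) n) ^ p) \<partial>iid {Suc m..m+n})"
    by (intro nn_integral_cong arg_cong[where f = "\<lambda>M. ennreal (N M ^ p)"] mat_prod_cong) auto
  finally show ?thesis by simp
qed

text \<open>
  The first \<open>m\<close> and the last \<open>n\<close> factors are independent.
\<close>

lemma Lp_moment_submultiplicative:
  assumes C: "0 < C" "\<And>A B. N (A ** B) \<le> C * N A * N B"
  shows "Lp_moment N p \<mu> (m + n) \<le> C ^ p * Lp_moment N p \<mu> m * Lp_moment N p \<mu> n"
proof -
  let ?I = "{1..m}" and ?J = "{Suc m..m+n}"
  have IJ: "{1..m+n} = ?I \<union> ?J" "?I \<inter> ?J = {}" by auto
  note N0 = is_normD(1)[OF N]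
  have merge: "N (mat_prod (merge ?I ?J (x, y)) (m + n)) \<le> C * N (mat_prod (\<lambda>i. y (i + m)) n) * N (mat_prod x m)" for x y
  proof -
    have "mat_prod (\<lambda>i. merge ?I ?J (x, y) (i + m)) n = mat_prod (\<lambda>i. y (i + m)) n"
      by (rule mat_prod_cong) (auto simp: merge_def)
    moreover have "mat_prod (merge ?I ?J (x, y)) m = mat_prod x m"
      by (rule mat_prod_cong) (auto simp: merge_def)
    ultimately show ?thesis unfolding mat_prod_add using C(2) by metis
  qed
  have "ennreal (Lp_moment N p \<mu> (m + n)) = (\<integral>\<^sup>+A. ennreal (N (mat_prod A (m + n)) ^ p) \<partial>iid (?I \<union> ?J))"
    unfolding Lp_moment_nn_integral IJ(1) ..
  also have "\<dots> = (\<integral>\<^sup>+x. (\<integral>\<^sup>+y. ennreal (N (mat_prod (merge ?I ?J (x, y)) (m + n)) ^ p) \<partial>iid ?J) \<partial>iid ?I)"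
  proof (rule P.product_nn_integral_fold[OF IJ(2)])
    show "(\<lambda>A. ennreal (N (mat_prod A (m + n)) ^ p)) \<in> borel_measurable (iid (?I \<union> ?J))"
      unfolding IJ(1)[symmetric] using measurable_norm_power by simp
  qed auto
  also have "\<dots> \<le> (\<integral>\<^sup>+x. (\<integral>\<^sup>+y. ennreal (C ^ p * N (mat_prod x m) ^ p) * ennreal (N (mat_prod (\<lambda>i. y (i + m)) n) ^ p) \<partial>iid ?J) \<partial>iid ?I)"
  proof (intro nn_integral_mono)
    fix x y
    have "N (mat_prod (merge ?I ?J (x, y)) (m + n)) ^ p \<le> (C * N (mat_prod (\<lambda>i. y (i + m)) n) * N (mat_prod x m)) ^ p"
      by (intro power_mono merge N0)
    also have "\<dots> = C ^ p * N (mat_prod x m) ^ p * N (mat_prod (\<lambda>i. y (i + m)) n) ^ p"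
      by (simp add: power_mult_distrib)
    finally show "ennreal (N (mat_prod (merge ?I ?J (x, y)) (m + n)) ^ p)
      \<le> ennreal (C ^ p * N (mat_prod x m) ^ p) * ennreal (N (mat_prod (\<lambda>i. y (i + m)) n) ^ p)"
      using C(1) N0 by (subst ennreal_mult[symmetric]) (auto intro: ennreal_leI)
  qed
  also have "\<dots> = (\<integral>\<^sup>+x. ennreal (C ^ p * N (mat_prod x m) ^ p) * ennreal (Lp_moment N p \<mu> n) \<partial>iid ?I)"
  proof (intro nn_integral_cong)
    fix x
    have "(\<lambda>y. mat_prod (\<lambda>i. y (i + m)) n) \<in> borel_measurable (iid ?J)"
    proof (rule measurable_mat_prod)
      fix i assume "i \<in> {1..n}"
      then have "(\<lambda>y. y (i + m)) \<in> iid ?J \<rightarrow>\<^sub>M \<mu>" by (intro measurable_component_singleton) auto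
      then show "(\<lambda>y. y (i + m)) \<in> borel_measurable (iid ?J)"
        using measurable_cong_sets[OF refl sets] by blast
    qed
    from measurable_compose[OF this measurable_N]
    show "(\<integral>\<^sup>+y. ennreal (C ^ p * N (mat_prod x m) ^ p) * ennreal (N (mat_prod (\<lambda>i. y (i + m)) n) ^ p) \<partial>iid ?J)
        = ennreal (C ^ p * N (mat_prod x m) ^ p) * ennreal (Lp_moment N p \<mu> n)"
      by (subst nn_integral_cmult) (auto simp: Lp_moment_shift)
  qed
  also have "\<dots> = (\<integral>\<^sup>+x. ennreal (C ^ p) * ennreal (Lp_moment N p \<mu> n) * ennreal (N (mat_prod x m) ^ p) \<partial>iid ?I)"
    using C(1) N0 by (intro nn_integral_cong) (simp add: ennreal_mult mult_ac)
  also have "\<dots> = ennreal (C ^ p) * ennreal (Lp_moment N p \<mu> n) * ennreal (Lp_moment N p \<mu> m)"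
    using measurable_norm_power by (subst nn_integral_cmult) (auto simp: Lp_moment_nn_integral)
  also have "\<dots> = ennreal (C ^ p * Lp_moment N p \<mu> m * Lp_moment N p \<mu> n)"
    using C(1) Lp_moment_nonneg by (simp add: ennreal_mult mult_ac)
  finally show ?thesis
    using C(1) Lp_moment_nonneg by (subst (asm) ennreal_le_iff) auto
qed

text \<open>
  Multiplying the moments by \<open>C ^ p\<close> makes them submultiplicative, and the extra factor disappears
  in the limit of the roots.
\<close>

lemma Lp_jsr_limit:
  assumes p: "1 \<le> p"
  shows "(\<lambda>k. Lp_moment N p \<mu> k powr (1 / (real p * real k))) \<longlonglongrightarrow> Lp_jsr N p \<mu>"
proof -
  obtain C where C: "0 < C" "\<And>A B. N (A ** B) \<le> C * N A * N B" using is_norm_matrix_mult_le[OF N] by blast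
  define D where "D = C ^ p"
  have D: "D > 0" using C by (simp add: D_def)
  define a where "a = (\<lambda>k. D * Lp_moment N p \<mu> k)"
  have "a (m + n) \<le> a m * a n" for m n
  proof -
    have "D * Lp_moment N p \<mu> (m + n) \<le> D * (D * Lp_moment N p \<mu> m * Lp_moment N p \<mu> n)"
      using Lp_moment_submultiplicative[OF C, of p m n] D by (intro mult_left_mono) (auto simp: D_def)
    then show ?thesis by (simp add: a_def mult_ac)
  qed
  moreover have a0: "0 \<le> a k" for k using D Lp_moment_nonneg by (simp add: a_def)
  ultimately have "convergent (\<lambda>k. a k powr (1 / real k))"
    by (intro submultiplicative_root_convergent) auto
  then obtain l where l: "(\<lambda>k. a k powr (1 / real k)) \<longlonglongrightarrow> l" by (auto simp: convergent_def)
  have "(\<lambda>k. (a k powr (1 / real k)) powr (1 / real p)) \<longlonglongrightarrow> l powr (1 / real p)"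
    using p by (intro tendsto_powr'[OF l tendsto_const]) auto
  moreover have "(\<lambda>k. ((1 / D) powr (1 / real k)) powr (1 / real p)) \<longlonglongrightarrow> 1 powr (1 / real p)"
    using D by (intro tendsto_powr[OF const_powr_inverse_tendsto_1 tendsto_const]) auto
  ultimately have "(\<lambda>k. (a k powr (1 / real k)) powr (1 / real p) * ((1 / D) powr (1 / real k)) powr (1 / real p))
      \<longlonglongrightarrow> l powr (1 / real p) * 1 powr (1 / real p)"
    by (rule tendsto_mult)
  moreover have "(a k powr (1 / real k)) powr (1 / real p) * ((1 / D) powr (1 / real k)) powr (1 / real p)
      = Lp_moment N p \<mu> k powr (1 / (real p * real k))" for k
  proof -
    have "(a k powr (1 / real k)) powr (1 / real p) * ((1 / D) powr (1 / real k)) powr (1 / real p)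
      = (a k * (1 / D)) powr (1 / (real k * real p))"
      unfolding powr_powr using a0 D by (subst powr_mult) auto
    then show ?thesis using D by (simp add: a_def mult.commute)
  qed
  ultimately have "convergent (\<lambda>k. Lp_moment N p \<mu> k powr (1 / (real p * real k)))"
    by (auto intro: convergentI)
  then show ?thesis unfolding Lp_jsr_def by (simp add: convergent_LIMSEQ_iff)
qed

lemma Lp_jsr_nonneg: "1 \<le> p \<Longrightarrow> 0 \<le> Lp_jsr N p \<mu>"
  by (rule LIMSEQ_le_const[OF Lp_jsr_limit]) auto

lemma Lp_jsr_le_jsr:
  assumes p: "1 \<le> p"
  shows "ereal (Lp_jsr N p \<mu>) \<le> jsr N (measure_support \<mu>)"
proof -
  let ?x = "\<lambda>k. Lp_moment N p \<mu> k powr (1 / (real p * real k))"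
  let ?s = "\<lambda>k. SUP A\<in>{1..k} \<rightarrow> measure_support \<mu>. ereal (N (mat_prod A k) powr (1 / real k))"
  have le: "ereal (?x k) \<le> ?s k" if k: "1 \<le> k" for k
  proof (cases "?s k = \<infinity>")
    case False
    obtain A0 where "A0 \<in> measure_support \<mu>"
    proof -
      have "\<not> (AE A in \<mu>. False)" using AE_False by simp
      then show ?thesis using AE_support that by (cases "measure_support \<mu> = {}") auto
    qed
    then have "ereal (N (mat_prod (\<lambda>_. A0) k) powr (1 / real k)) \<le> ?s k"
      by (intro SUP_upper) auto
    then have "0 \<le> ?s k" by (rule order_trans[rotated]) simp
    with False obtain t where t: "?s k = ereal t" "0 \<le> t" by (cases "?s k") auto
    have "N (mat_prod A k) \<le> t ^ k" if A: "\<forall>i\<in>{1..k}. A i \<in> measure_support \<mu>" for A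
    proof -
      have "ereal (N (mat_prod A k) powr (1 / real k)) \<le> ereal t"
        unfolding t(1)[symmetric] using A by (intro SUP_upper) auto
      then have *: "N (mat_prod A k) powr (1 / real k) \<le> t" by simp
      show ?thesis
      proof (cases "N (mat_prod A k) = 0")
        case False
        then have "0 < N (mat_prod A k)" using is_normD(1)[OF N, of "mat_prod A k"] by simp
        then have "N (mat_prod A k) = (N (mat_prod A k) powr (1 / real k)) ^ k"
          using k by (simp add: powr_realpow[symmetric] powr_powr)
        also have "\<dots> \<le> t ^ k" using * by (intro power_mono) auto
        finally show ?thesis .
      qed (use t in simp)
    qed
    then have "Lp_moment N p \<mu> k \<le> (t ^ k) ^ p" using t by (intro Lp_moment_le) auto
    then have "?x k \<le> ((t ^ k) ^ p) powr (1 / (real p * real k))"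
      using Lp_moment_nonneg by (intro powr_mono2) auto
    also have "\<dots> = t"
    proof (cases "t = 0")
      case False
      then have "0 < t" using t(2) by simp
      then show ?thesis using k p by (simp add: power_mult[symmetric] powr_realpow[symmetric] powr_powr)
    qed (use k p in simp)
    finally show ?thesis using t by simp
  qed simp
  have "(\<lambda>k. ereal (?x k)) \<longlonglongrightarrow> ereal (Lp_jsr N p \<mu>)"
    using Lp_jsr_limit[OF p] by simp
  then have "ereal (Lp_jsr N p \<mu>) = limsup (\<lambda>k. ereal (?x k))"
    by (intro lim_imp_Limsup[symmetric]) auto
  also have "\<dots> \<le> limsup ?s"
    by (intro Limsup_mono eventually_sequentiallyI[of 1]) (rule le)
  finally show ?thesis by (simp add: jsr_def)
qed

end

section \<open>The two radii\<close>

context iid_matrices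
begin

interpretation prob_space \<mu> by (rule prob)
interpretation P: product_prob_space "\<lambda>_::nat. \<mu>" by unfold_locales

lemma Lp_moment_ge:
  assumes E: "\<And>i. E i \<in> sets \<mu>" and d: "0 \<le> d" "\<And>i. d \<le> prob (E i)"
    and b: "0 \<le> b" "\<And>A. (\<forall>i\<in>{1..k}. A i \<in> E i) \<Longrightarrow> b \<le> N (mat_prod A k)"
  shows "d ^ k * b ^ p \<le> Lp_moment N p \<mu> k"
proof -
  interpret PK: prob_space "iid {1..k}" by (rule prob_space_PiM) (rule prob)
  interpret F: finite_product_prob_space "\<lambda>_::nat. \<mu>" "{1..k}" by standard simp
  let ?F = "Pi\<^sub>E {1..k} E"
  have F: "?F \<in> sets (iid {1..k})" using E by (intro sets_PiM_I_finite) auto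
  have "d ^ k = (\<Prod>i\<in>{1..k}. d)" by simp
  also have "\<dots> \<le> (\<Prod>i\<in>{1..k}. prob (E i))" using d by (intro prod_mono) auto
  also have "\<dots> = PK.prob ?F"
    using E by (intro F.prob_times[symmetric]) auto
  finally have "d ^ k * b ^ p \<le> PK.prob ?F * b ^ p" using b(1) by (intro mult_right_mono) auto
  also have "\<dots> = (\<integral>A. indicator ?F A * b ^ p \<partial>iid {1..k})" using F by simp
  also have "\<dots> \<le> (\<integral>A. N (mat_prod A k) ^ p \<partial>iid {1..k})"
  proof (rule integral_mono)
    show "integrable (iid {1..k}) (\<lambda>A. indicator ?F A * b ^ p)"
      using PK.emeasure_finite[of ?F]
      by (intro integrable_mult_left integrable_real_indicator F) (simp only: less_top infinity_ennreal_def)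
    show "indicator ?F A * b ^ p \<le> N (mat_prod A k) ^ p" for A
    proof (cases "A \<in> ?F")
      case True
      then have "b \<le> N (mat_prod A k)" by (intro b(2)) auto
      then show ?thesis using True b(1) by (simp add: power_mono)
    qed (use is_normD(1)[OF N] in simp)
  qed (rule integrable_norm_power)
  finally show ?thesis by (simp add: Lp_moment_def)
qed

text \<open>
  On the event that every factor \<open>A i\<close> dominates \<open>X i\<close>, monotonicity gives
  \<open>A m \<dots> A 1 v \<ge> X m \<dots> X 1 v\<close>, and periodicity gives \<open>X (n k) \<dots> X 1 v \<ge> q ^ (n k) v\<close>. The functional
  \<open>a\<close> turns this into a lower bound for the norm. The probability of the event contributes the
  factor \<open>d powr (1/p)\<close>, which does not deteriorate with \<open>n\<close>.
\<close>

lemma Lp_jsr_ge: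
  assumes frame: "cone_frame K a u c r"
    and k: "1 \<le> k" and per: "\<And>i. X (i + k) = X i" and XK: "\<And>i. X i \<in> cone_maps K"
    and d: "0 < d" "\<And>i. d \<le> prob {Y. Y - X i \<in> cone_maps K}"
    and v: "v \<in> K" "v \<noteq> 0" and q: "0 < q" "mat_prod X k *v v - q ^ k *\<^sub>R v \<in> K"
    and p: "1 \<le> p"
  shows "d powr (1 / real p) * q \<le> Lp_jsr N p \<mu>"
proof -
  interpret cone_frame K a u c r by fact
  define E where "E = (\<lambda>i. {Y. Y - X i \<in> cone_maps K})"
  have Em: "E i \<in> sets \<mu>" for i
  proof -
    have "(\<lambda>Y. Y - X i) -` cone_maps K \<inter> space borel \<in> sets borel"
      using closed_cone_maps[OF KD(1)] by (intro measurable_sets[where A = borel]) auto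
    then show ?thesis using sets by (simp add: E_def vimage_def)
  qed
  have mono: "mat_prod A m *v v - mat_prod X m *v v \<in> K" if A: "\<forall>i\<in>{1..m}. A i \<in> E i" for A m
    using A
  proof (induction m)
    case 0
    then show ?case by (simp add: zero_in)
  next
    case (Suc m)
    let ?y = "mat_prod X m *v v" and ?z = "mat_prod A m *v v"
    have IH: "?z - ?y \<in> K" using Suc by simp
    have y: "?y \<in> K" using cone_maps_mat_prod[of m X K] XK v(1) by (auto simp: cone_maps_def)
    have D: "A (Suc m) - X (Suc m) \<in> cone_maps K" using Suc.prems by (auto simp: E_def)
    have "A (Suc m) *v (?z - ?y) = X (Suc m) *v (?z - ?y) + (A (Suc m) - X (Suc m)) *v (?z - ?y)"
      by (simp add: matrix_vector_mult_diff_rdistrib)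
    also have "\<dots> \<in> K" using XK D IH by (intro KD(4)) (auto simp: cone_maps_def)
    finally have "A (Suc m) *v (?z - ?y) + (A (Suc m) - X (Suc m)) *v ?y \<in> K"
      using D y by (intro KD(4)) (auto simp: cone_maps_def)
    then show ?case
      by (simp add: matrix_vector_mul_assoc[symmetric] matrix_vector_mult_diff_distrib matrix_vector_mult_diff_rdistrib)
  qed
  have per': "X (i + n * k) = X i" for i n
  proof (induction n)
    case (Suc n)
    have "X (i + Suc n * k) = X ((i + n * k) + k)" by (simp add: algebra_simps)
    then show ?case using per Suc by simp
  qed simp
  have grow: "mat_prod X (n * k) *v v - (q ^ k) ^ n *\<^sub>R v \<in> K" for n
  proof (induction n)
    case 0
    then show ?case by (simp add: zero_in)
  next
    case (Suc n)
    have "mat_prod X (n * k + k) *v v = mat_prod X k *v (mat_prod X (n * k) *v v)"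
      unfolding mat_prod_mv_add per' ..
    moreover have "mat_prod X k *v (mat_prod X (n * k) *v v - (q ^ k) ^ n *\<^sub>R v) \<in> K"
      using cone_maps_mat_prod[of k X K] XK Suc by (auto simp: cone_maps_def)
    moreover have "(q ^ k) ^ n *\<^sub>R (mat_prod X k *v v - q ^ k *\<^sub>R v) \<in> K"
      using q by (intro KD(3)) auto
    ultimately have "mat_prod X (n * k + k) *v v - (q ^ k) ^ n *\<^sub>R (mat_prod X k *v v)
        + ((q ^ k) ^ n *\<^sub>R (mat_prod X k *v v) - (q ^ k) ^ Suc n *\<^sub>R v) \<in> K"
      by (intro KD(4)) (simp_all add: matrix_vector_mult_diff_distrib matrix_vector_mult_scaleR scaleR_diff_right mult.commute)
    then show ?case by (simp add: add.commute)
  qed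
  have "c * norm v > 0" using c v(2) by simp
  then have av: "a \<bullet> v > 0" using a[OF v(1)] by linarith
  obtain C where C: "0 < C" "\<And>A. norm A \<le> C * N A" using norm_le_is_norm[OF N] by blast
  define D where "D = norm a * real CARD('n) ^ 2 * C * norm v"
  have D: "0 < D" unfolding D_def using av C(1) by (intro mult_pos_pos) (auto simp: zero_less_power)
  define b where "b = (a \<bullet> v) / D"
  have b: "b > 0" using av D by (simp add: b_def)
  have NZ: "b * q ^ (n * k) \<le> N (mat_prod A (n * k))" if A: "\<forall>i\<in>{1..n * k}. A i \<in> E i" for A n
  proof -
    let ?Z = "mat_prod A (n * k)"
    have "a \<bullet> (?Z *v v - mat_prod X (n * k) *v v) \<ge> 0" "a \<bullet> (mat_prod X (n * k) *v v - (q ^ k) ^ n *\<^sub>R v) \<ge> 0"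
      using mono[OF A] grow by (auto intro: a_nonneg)
    then have "q ^ (n * k) * (a \<bullet> v) \<le> a \<bullet> (?Z *v v)"
      by (simp add: inner_diff_right power_mult mult.commute[of n k])
    also have "\<dots> \<le> norm a * norm (?Z *v v)" by (rule norm_cauchy_schwarz)
    also have "\<dots> \<le> norm a * (real CARD('n) ^ 2 * norm ?Z * norm v)"
      by (intro mult_left_mono norm_matrix_vector_le) auto
    also have "\<dots> \<le> norm a * (real CARD('n) ^ 2 * (C * N ?Z) * norm v)"
      by (intro mult_left_mono mult_right_mono C) auto
    also have "\<dots> = D * N ?Z" by (simp add: D_def)
    finally show ?thesis using D by (simp add: b_def field_simps)
  qed
  let ?x = "\<lambda>k. Lp_moment N p \<mu> k powr (1 / (real p * real k))"
  have low: "d powr (1 / real p) * (b powr (1 / real (n * k)) * q) \<le> ?x (n * k)" if n: "1 \<le> n" for n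
  proof -
    let ?m = "n * k"
    have m: "1 \<le> ?m" using n k by (metis One_nat_def mult_le_mono mult_1)
    have "d ^ ?m * (b * q ^ ?m) ^ p \<le> Lp_moment N p \<mu> ?m"
      using d b q NZ Em by (intro Lp_moment_ge[where E = E]) (auto simp: E_def)
    then have "(d ^ ?m * (b * q ^ ?m) ^ p) powr (1 / (real p * real ?m)) \<le> ?x ?m"
      using d b q by (intro powr_mono2) auto
    moreover have "(d ^ ?m * (b * q ^ ?m) ^ p) powr (1 / (real p * real ?m))
        = d powr (1 / real p) * (b powr (1 / real ?m) * q)"
    proof -
      have 1: "(d ^ ?m) powr (1 / (real p * real ?m)) = d powr (1 / real p)"
        unfolding powr_realpow[OF d(1), symmetric] powr_powr using m p by simp
      have bq: "0 < b * q ^ ?m" using b q by simp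
      have "((b * q ^ ?m) ^ p) powr (1 / (real p * real ?m)) = (b * q ^ ?m) powr (1 / real ?m)"
        unfolding powr_realpow[OF bq, symmetric] powr_powr using m p by simp
      also have "\<dots> = b powr (1 / real ?m) * q" by (rule root_of_geometric[OF b q(1) m])
      finally show ?thesis using 1 d b q by (subst powr_mult) auto
    qed
    ultimately show ?thesis by simp
  qed
  have sub: "strict_mono (\<lambda>n. n * k)" using k by (intro strict_monoI) simp
  have "(\<lambda>n. d powr (1 / real p) * (b powr (1 / real (n * k)) * q)) \<longlonglongrightarrow> d powr (1 / real p) * (1 * q)"
    using LIMSEQ_subseq_LIMSEQ[OF const_powr_inverse_tendsto_1[OF b] sub]
    by (intro tendsto_intros) (simp add: comp_def)
  moreover have "(\<lambda>n. ?x (n * k)) \<longlonglongrightarrow> Lp_jsr N p \<mu>"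
    using LIMSEQ_subseq_LIMSEQ[OF Lp_jsr_limit[OF p] sub] by (simp add: comp_def)
  ultimately have "d powr (1 / real p) * (1 * q) \<le> Lp_jsr N p \<mu>"
    using low by (intro LIMSEQ_le) blast+
  then show ?thesis by simp
qed

end

lemma jsr_le:
  assumes "0 < t" "0 \<le> C" and le: "\<And>k A. \<forall>i\<in>{1..k}. A i \<in> \<M> \<Longrightarrow> N (mat_prod A k) \<le> C * t ^ k"
    and N: "is_norm N"
  shows "jsr N \<M> \<le> ereal t"
proof -
  let ?x = "\<lambda>k. (C + 1) powr (1 / real k) * t"
  have "(SUP A\<in>{1..k} \<rightarrow> \<M>. ereal (N (mat_prod A k) powr (1 / real k))) \<le> ereal (?x k)" if k: "1 \<le> k" for k
  proof (rule SUP_least)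
    fix A assume A: "A \<in> {1..k} \<rightarrow> \<M>"
    have "N (mat_prod A k) \<le> C * t ^ k" using A by (intro le) auto
    also have "\<dots> \<le> (C + 1) * t ^ k" using assms by (intro mult_right_mono) auto
    finally have "N (mat_prod A k) powr (1 / real k) \<le> ((C + 1) * t ^ k) powr (1 / real k)"
      using is_normD(1)[OF N] by (intro powr_mono2) auto
    then show "ereal (N (mat_prod A k) powr (1 / real k)) \<le> ereal (?x k)"
      using root_of_geometric[of "C + 1" t k] assms k by simp
  qed
  then have "jsr N \<M> \<le> limsup (\<lambda>k. ereal (?x k))"
    unfolding jsr_def by (intro Limsup_mono eventually_sequentiallyI[of 1])
  also have "\<dots> = ereal (1 * t)"
  proof (intro lim_imp_Limsup)
    show "(\<lambda>k. ereal (?x k)) \<longlonglongrightarrow> ereal (1 * t)"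
      unfolding lim_ereal using assms by (intro tendsto_intros const_powr_inverse_tendsto_1) auto
  qed simp
  finally show ?thesis by simp
qed

text \<open>
  Uniform bounds for products of fixed length pass to the closure. This is where a dense set of charged
  matrices replaces the support without any continuity of the spectral radius.
\<close>

lemma mat_prod_bound_closure:
  fixes G :: "(real^'n^'n) set"
  assumes N: "is_norm N" and bd: "\<And>A. \<forall>i. A i \<in> G \<Longrightarrow> N (mat_prod A k) \<le> b"
    and dense: "\<M> \<subseteq> closure G" and A: "\<forall>i\<in>{1..k}. A i \<in> \<M>" and G: "G \<noteq> {}"
  shows "N (mat_prod A k) \<le> b"
proof -
  have "\<exists>S. (\<forall>n. S n \<in> G) \<and> (i \<in> {1..k} \<longrightarrow> S \<longlonglongrightarrow> A i)" for i
  proof (cases "i \<in> {1..k}")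
    case True
    then show ?thesis using A dense closure_sequential[of "A i" G] by blast
  next
    case False
    obtain g where "g \<in> G" using G by blast
    with False show ?thesis by (intro exI[of _ "\<lambda>_. g"]) blast
  qed
  then obtain S where S: "\<And>i n. S i n \<in> G" "\<And>i. i \<in> {1..k} \<Longrightarrow> S i \<longlonglongrightarrow> A i" by metis
  have mult: "(\<lambda>n. X n ** Y n) \<longlonglongrightarrow> x ** y" if "X \<longlonglongrightarrow> x" "Y \<longlonglongrightarrow> y"
    for X Y :: "nat \<Rightarrow> real^'n^'n" and x y
    unfolding matrix_matrix_mult_def using that by (intro tendsto_intros)
  have "(\<lambda>n. mat_prod (\<lambda>i. S i n) j) \<longlonglongrightarrow> mat_prod A j" if "j \<le> k" for j
    using that
  proof (induction j)
    case (Suc j)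
    then show ?case using S(2)[of "Suc j"] by (simp add: mult)
  qed simp
  then have "(\<lambda>n. mat_prod (\<lambda>i. S i n) k) \<longlonglongrightarrow> mat_prod A k" by simp
  moreover have "isCont N (mat_prod A k)"
    using is_norm_continuous[OF N, of UNIV] by (simp add: continuous_on_eq_continuous_at)
  ultimately have "(\<lambda>n. N (mat_prod (\<lambda>i. S i n) k)) \<longlonglongrightarrow> N (mat_prod A k)"
    by (rule isCont_tendsto_compose[rotated])
  then show ?thesis by (rule LIMSEQ_le_const2) (use bd S(1) in auto)
qed

lemma is_norm_mat_prod_bound:
  fixes G :: "(real^'n^'n) set"
  assumes N: "is_norm N" and C: "0 \<le> C"
    and bd: "\<forall>k B x. (\<forall>i. B i \<in> G) \<longrightarrow> norm (mat_prod B k *v x) \<le> C * t ^ k * norm x"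
  shows "\<exists>C'\<ge>0. \<forall>k B. (\<forall>i. B i \<in> G) \<longrightarrow> N (mat_prod B k) \<le> C' * t ^ k"
proof -
  obtain c where c: "0 < c" "\<And>A. N A \<le> c * norm A" using is_norm_le_norm[OF N] by blast
  have "N (mat_prod B k) \<le> (c * real CARD('n) ^ 2 * C) * t ^ k" if "\<forall>i. B i \<in> G" for B k
  proof -
    have "norm (mat_prod B k) \<le> real CARD('n) ^ 2 * (C * t ^ k)"
      by (rule norm_matrix_le) (use bd that in simp)
    then have "c * norm (mat_prod B k) \<le> c * (real CARD('n) ^ 2 * (C * t ^ k))"
      using c(1) by (intro mult_left_mono) auto
    with c(2)[of "mat_prod B k"] show ?thesis by (simp add: mult.assoc)
  qed
  then show ?thesis using c(1) C by (intro exI[of _ "c * real CARD('n) ^ 2 * C"]) simp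
qed

text \<open>
  Otherwise every product would have spectral radius below \<open>q ^ k\<close> by the Perron theorem, and the
  Berger-Wang bound would force the joint spectral radius below any \<open>t > q\<close>.
\<close>

lemma subeigenvector_of_jsr:
  fixes K :: "(real^'n) set"
  assumes frame: "cone_frame K a u c r" and N: "is_norm N"
    and G: "G \<subseteq> cone_maps K" "G \<noteq> {}" "bounded G" and dense: "\<M> \<subseteq> closure G"
    and q: "0 < q" "ereal q < jsr N \<M>"
  shows "\<exists>k\<ge>1. \<exists>B v. (\<forall>i. B i \<in> G) \<and> v \<in> K \<and> v \<noteq> 0 \<and> mat_prod B k *v v - q ^ k *\<^sub>R v \<in> K"
proof (rule ccontr)
  assume contra: "\<not> ?thesis"
  interpret cone_frame K a u c r by fact
  obtain t where t: "q < t" "ereal t < jsr N \<M>" using ereal_dense2[OF q(2)] by auto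
  have eig: "norm z \<le> q ^ k"
    if k: "1 \<le> k" and B: "\<forall>i. B i \<in> G" and z: "real_eigenpair ((*v) (mat_prod B k)) z" for k B z
  proof (rule ccontr)
    assume big: "\<not> norm z \<le> q ^ k"
    have "mat_prod B k \<in> cone_maps K" using B G(1) by (intro cone_maps_mat_prod) auto
    then have "(*v) (mat_prod B k) ` K \<subseteq> K" by (auto simp: cone_maps_def)
    from perron_eigenvector[OF matrix_vector_mul_linear this z]
    obtain x l where x: "x \<in> K" "x \<noteq> 0" "norm z \<le> l" "mat_prod B k *v x = l *\<^sub>R x" by blast
    have "(l - q ^ k) *\<^sub>R x \<in> K" using x big by (intro KD(3)) auto
    then have "mat_prod B k *v x - q ^ k *\<^sub>R x \<in> K" by (simp add: x(4) scaleR_diff_left)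
    with contra k B x(1,2) show False by blast
  qed
  have "\<exists>C\<ge>0. \<forall>k B x. (\<forall>i. B i \<in> G) \<longrightarrow> norm (mat_prod B k *v x) \<le> C * t ^ k * norm x"
    by (rule Berger_Wang_bound[OF G(2,3) q(1) t(1)]) (rule eig; assumption)
  then obtain C where CC: "0 \<le> C \<and> (\<forall>k B x. (\<forall>i. B i \<in> G) \<longrightarrow> norm (mat_prod B k *v x) \<le> C * t ^ k * norm x)" ..
  from is_norm_mat_prod_bound[OF N conjunct1[OF CC] conjunct2[OF CC]]
  obtain C' where CC': "0 \<le> C' \<and> (\<forall>k B. (\<forall>i. B i \<in> G) \<longrightarrow> N (mat_prod B k) \<le> C' * t ^ k)" ..
  have C': "N (mat_prod B k) \<le> C' * t ^ k" if "\<forall>i. B i \<in> G" for k B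
    using CC' that by simp
  have "jsr N \<M> \<le> ereal t"
  proof (rule jsr_le[OF _ conjunct1[OF CC'] _ N])
    show "N (mat_prod A k) \<le> C' * t ^ k" if "\<forall>i\<in>{1..k}. A i \<in> \<M>" for A k
      using mat_prod_bound_closure[OF N C' dense that G(2)] .
  qed (use q t in simp)
  with t(2) show False by simp
qed

lemma proper_cone_frame:
  fixes K :: "'a::euclidean_space set"
  assumes "proper_cone K"
  obtains a u c r where "cone_frame K a u c r"
proof -
  obtain a c where a: "0 < c" "\<And>x. x \<in> K \<Longrightarrow> c * norm x \<le> a \<bullet> x"
    using proper_cone_functional[OF assms] by blast
  obtain u e where u: "0 < e" "ball u e \<subseteq> K"
    using proper_coneD(6)[OF assms] by (auto simp: mem_interior)
  have "u + y \<in> K" if "norm y \<le> e / 2" for y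
    using u that by (intro subsetD[OF u(2)]) (simp add: dist_norm)
  then have "cone_frame K a u c (e / 2)"
    using assms a u(1) by unfold_locales auto
  then show ?thesis by (rule that)
qed

theorem mainTheorem3:
  fixes \<mu> \<mu>s :: "(real^'n^'n) measure"
    and nrm :: "real^'n^'n \<Rightarrow> real"
    and K :: "(real^'n) set"
    and m :: nat
    and w :: "nat \<Rightarrow> real"
    and M :: "nat \<Rightarrow> real^'n^'n"
  assumes "is_norm nrm"
    and "prob_space \<mu>" and "sets \<mu> = sets borel"
    and "compact (measure_support \<mu>)"
    and "proper_cone K" and "leaves_invariant (measure_support \<mu>) K"
    and "singular_part \<mu> \<mu>s"
    and "\<And>i. i < m \<Longrightarrow> 0 < w i"
    and "\<And>B. B \<in> sets borel \<Longrightarrow>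
           emeasure \<mu>s B = (\<Sum>i<m. ennreal (w i) * emeasure (return borel (M i)) B)"
  shows "(\<lambda>p. ereal (Lp_jsr nrm p \<mu>)) \<longlonglongrightarrow> jsr nrm (measure_support \<mu>)"
proof -
  let ?S = "measure_support \<mu>" and ?P = "cone_maps K"
  interpret prob_space \<mu> by fact
  have null: "- ?S \<in> null_sets \<mu>"
    using emeasure_compl_support[OF assms(3)] closed_measure_support[of \<mu>] assms(3)
    by (auto simp: null_sets_def borel_comp)
  have AE_S: "AE A in \<mu>. A \<in> ?S" by (rule AE_I'[OF null]) auto
  interpret iid_matrices \<mu> nrm by unfold_locales (fact assms AE_S)+
  obtain a u c r where frame: "cone_frame K a u c r" using proper_cone_frame[OF assms(5)] by blast
  have SP: "?S \<subseteq> ?P" using assms(6) by (auto simp: leaves_invariant_def cone_maps_def)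
  define G where "G = {X \<in> ?S. emeasure \<mu> {Y. Y - X \<in> ?P} > 0}"
  have "?S \<noteq> {}"
  proof
    assume "?S = {}"
    with AE_S show False by simp
  qed
  have dense: "?S \<subseteq> closure G"
  proof
    fix A assume A: "A \<in> ?S"
    show "A \<in> closure G" unfolding closure_approachable G_def
      using charged_translates_dense[OF frame assms(3,7,8,9) A] by blast
  qed
  have Gne: "G \<noteq> {}" using dense \<open>?S \<noteq> {}\<close> by auto
  have Gb: "bounded G" using compact_imp_bounded[OF assms(4)] by (rule bounded_subset) (auto simp: G_def)
  have GP: "G \<subseteq> ?P" using SP by (auto simp: G_def)
  show ?thesis
  proof (rule order_tendstoI)
    fix y assume y: "jsr nrm ?S < y"
    show "eventually (\<lambda>p. ereal (Lp_jsr nrm p \<mu>) < y) sequentially"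
      using Lp_jsr_le_jsr y by (intro eventually_sequentiallyI[of 1]) (auto intro: le_less_trans)
  next
    fix y assume y: "y < jsr nrm ?S"
    show "eventually (\<lambda>p. y < ereal (Lp_jsr nrm p \<mu>)) sequentially"
    proof (cases "y < 0")
      case True
      then show ?thesis using Lp_jsr_nonneg
        by (intro eventually_sequentiallyI[of 1]) (auto intro: less_le_trans)
    next
      case False
      obtain q where q: "y < ereal q" "ereal q < jsr nrm ?S" using ereal_dense2[OF y] by blast
      have "0 < ereal q" using False q(1) by (metis le_less_trans not_less)
      then have q0: "0 < q" by simp
      obtain k B v where k: "1 \<le> k" and B: "\<And>i. B i \<in> G" and v: "v \<in> K" "v \<noteq> 0"
        and Bv: "mat_prod B k *v v - q ^ k *\<^sub>R v \<in> K"
        using subeigenvector_of_jsr[OF frame assms(1) GP Gne Gb dense q0 q(2)] by auto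
      \<comment> \<open>The factors are repeated with period \<open>k\<close>; residue \<open>0\<close> stands for the factor \<open>B k\<close>.\<close>
      define X where "X = (\<lambda>i. B (if i mod k = 0 then k else i mod k))"
      have XG: "X i \<in> G" for i using B by (simp add: X_def)
      have per: "X (i + k) = X i" for i by (simp add: X_def)
      have "mat_prod X k = mat_prod B k"
        by (rule mat_prod_cong) (auto simp: X_def le_eq_less_or_eq)
      then have Xv: "mat_prod X k *v v - q ^ k *\<^sub>R v \<in> K" using Bv by simp
      have Xpos: "0 < prob {Y. Y - X i \<in> ?P}" for i
        using XG[of i] by (simp add: G_def emeasure_eq_measure)
      define d where "d = Min ((\<lambda>i. prob {Y. Y - B i \<in> ?P}) ` {1..k})"
      have d0: "0 < d" unfolding d_def using k B
        by (subst Min_gr_iff) (auto simp: G_def emeasure_eq_measure)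
      have d: "d \<le> prob {Y. Y - X i \<in> ?P}" for i
      proof -
        have "(if i mod k = 0 then k else i mod k) \<in> {1..k}" using k by (auto intro: less_imp_le)
        then show ?thesis unfolding d_def X_def by (intro Min_le imageI finite_imageI) auto
      qed
      have "(\<lambda>p. ereal (d powr (1 / real p) * q)) \<longlonglongrightarrow> ereal (1 * q)"
        unfolding lim_ereal by (intro tendsto_intros const_powr_inverse_tendsto_1 d0)
      then have "eventually (\<lambda>p. y < ereal (d powr (1 / real p) * q)) sequentially"
        using q(1) by (intro order_tendstoD(1)[of _ "ereal (1 * q)"]) auto
      then show ?thesis using eventually_ge_at_top[of 1]
      proof eventually_elim
        case (elim p)
        have "d powr (1 / real p) * q \<le> Lp_jsr nrm p \<mu>"
          using Lp_jsr_ge[OF frame k per _ d0 d v q0 Xv elim(2)] XG GP by blast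
        with elim(1) show ?case by (meson ereal_less_eq(3) less_le_trans)
      qed
    qed
  qed
qed

end
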